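(* Let $V$ be a vertex operator algebra and let $M^1,M^2,M^3$ be $V$-modules (in the sense of the context) such that, for complex numbers $h_i$ and nonnegative integers $k_i$ ($i=1,2,3$), $M^i=\bigoplus_{n=0}^\infty M^i_{(h_i+n)}$ and $M^i\in\mathscr{C}_{k_i}$. Put $A=\{1,2,\infty\}$, $p_A=\{0,1,\infty\}\subset\mathbb{P}^1$ (with $p_1=0$, $p_2=1$, $p_\infty=\infty$) and $M_A=M^1\otimes M^2\otimes M^3$. Then the space of conformal blocks $C^*(M_A,p_A)$ is isomorphic, as a complex vector space, to the space of logarithmic intertwining operators of the type $\binom{D(M^3)}{M^2\ M^1}$, i.e. to the space of logarithmic intertwining operators $I(-,z):M^2\to\mathrm{Hom}_{\mathbb{C}}(M^1,D(M^3))\{z\}[\log z]$.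
   Context: $\mathbb{N}=\{0,1,2,\dots\}$. $V=\bigoplus_{k\ge0}V_k$ is a vertex operator algebra (standard definition) with $\dim V_k<\infty$, vertex operator $Y(a,z)=\sum_{n\in\mathbb{Z}}a_{(n)}z^{-n-1}$, vacuum $\mathbf 1\in V_0$, Virasoro vector $\omega\in V_2$, $L_n=\omega_{(n+1)}$, $L_0a=ka$ for $a\in V_k$; write $|a|=k$ for $a\in V_k$. Modules. A $V$-module here is a weak $V$-module $M$ for which there exist $h\in\mathbb{C}$ and $k\in\mathbb{N}$ with $M=\bigoplus_{n=0}^\infty M_{(h+n)}$, $M_{(h+n)}=\{u\in M:(L_0-h-n)^{k+1}u=0\}$, and $\dim M_{(h+n)}<\infty$ for all $n$; write $|u|=h+n$ for $u\in M_{(h+n)}$. $\mathscr{C}_k$ denotes the category of such modules whose homogeneous subspaces $M_{(h+n)}$ are annihilated by $(L_0-h-n)^{k+1}$. Current Lie algebra and duality. Let $V^{(1)}=\bigoplus_k V_k\otimes\mathbb{C}((\xi))(d\xi)^{1-k}$, $V^{(0)}=\bigoplus_k V_k\otimes\mathbb{C}((\xi))(d\xi)^{-k}$, $\nabla(v\otimes f(d\xi)^{-k})=L_{-1}v\otimes f(d\xi)^{-k}+v\otimes f'(d\xi)^{1-k}$, and $\mathfrak g=V^{(1)}/\nabla V^{(0)}$ (a Lie algebra); $J(a,f)$ denotes the class of $a\otimes f(\xi)(d\xi)^{1-|a|}$ and $J_n(a)=J(a,\xi^{n+|a|-1})$. Every $V$-module $M$ is a $\mathfrak g$-module via $J(a,\sum_m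 c_m\xi^m)u=\sum_m c_m a_{(m)}u$ (in particular $J_n(a)u=a_{(|a|-1+n)}u$). Let $\theta(J_n(a))=(-1)^{|a|}\sum_{j\ge0}\frac{1}{j!}J_{-n}(L_1^ja)$ (an anti-involution of the subalgebra spanned by the $J_n(a)$). For a module $M=\bigoplus_n M_{(h+n)}$, $D(M)=\bigoplus_n M_{(h+n)}^*$ is the restricted dual, with $\langle J_n(a)\varphi,u\rangle=\langle\varphi,\theta(J_n(a))u\rangle$; this extends uniquely to a $V$-module structure on $D(M)$, and $D(M)\in\mathscr{C}_k$ if $M\in\mathscr{C}_k$. Conformal blocks at $\{0,1,\infty\}$. For $a\in V_k$ and $f\in\mathbb{C}[z,z^{-1},(z-1)^{-1}]$ (i.e. $f(z)(dz)^{1-k}$ a meromorphic $(1-k)$-differential on $\mathbb{P}^1$ with poles only at $0,1,\infty$), let $f_0(\xi)=\sum_m c_m\xi^m$ be the Laurent expansion of $f$ at $z=0$ in $\xi=z$, $f_1(\xi)=\sum_m d_m\xi^m$ the expansion at $z=1$ in $\xi=z-1$, and $f_\infty(\xi)=\sum_{n\le n_0}f_n\xi^{n+k-1}$ the expansion at $z=\infty$ in $\xi=z$ (a Laurent series in $\xi^{-1}$). Define operators $X^{(1)}=\sum_m c_m a_{(m)}$ on $M^1$, $X^{(2)}=\sum_m d_m a_{(m)}$ on $M^2$, and $X^{(\infty)}=-\sum_{n\le n_0}f_n\,\theta(J_n(a))$ on $M^3$ (each acts by a finite sum on any vector). Let $\mathfrak g^{out}_{p_A}M_A$ be the span of all vectors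 $X^{(1)}u_1\otimes u_2\otimes u_3+u_1\otimes X^{(2)}u_2\otimes u_3+u_1\otimes u_2\otimes X^{(\infty)}u_3$ over all such $a,f$ and $u_i\in M^i$. The space of conformal blocks is $C^*(M_A,p_A)=\mathrm{Hom}_{\mathbb{C}}(M_A/\mathfrak g^{out}_{p_A}M_A,\mathbb{C})$. Logarithmic intertwining operators. For weak $V$-modules $W^1,W^2,W^3$, a logarithmic intertwining operator of type $\binom{W^3}{W^1\ W^2}$ is a linear map $I(-,z):W^1\to\mathrm{Hom}_{\mathbb{C}}(W^2,W^3)\{z\}[\log z]$, $I(u,z)=\sum_{n=0}^d\sum_{\alpha\in\mathbb{C}}u^n_{(\alpha)}z^{-\alpha-1}(\log z)^n$, such that: (i) for all $u_1\in W^1,u_2\in W^2$ and $0\le n\le d$, $(u_1)^n_{(\alpha)}u_2=0$ for $\mathrm{Re}(\alpha)$ sufficiently large; (ii) $I(L_{-1}u_1,z)=\frac{d}{dz}I(u_1,z)$; (iii) for all $a\in V$, $u_1\in W^1$, $\alpha\in\mathbb{C}$, $0\le n\le d$, $p,q\in\mathbb{Z}$: $\sum_{i\ge0}\binom{p}{i}(a_{(q+i)}u_1)^n_{(\alpha+p-i)}=\sum_{i\ge0}(-1)^i\binom{q}{i}\bigl(a_{(p+q-i)}(u_1)^n_{(\alpha+i)}-(-1)^q(u_1)^n_{(\alpha+q-i)}a_{(p+i)}\bigr)$ as operators on $W^2$. *)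

theory Defs
  imports Complex_Main "HOL-Computational_Algebra.Polynomial"
    "HOL-Computational_Algebra.Formal_Laurent_Series" "HOL-Library.Function_Algebras"
begin

text \<open>Sum of a family with finite support (all sums below are of this kind).\<close>
definition fsum :: "('i \<Rightarrow> 'a::comm_monoid_add) \<Rightarrow> 'a" where
  "fsum g = sum g {i. g i \<noteq> 0}"

definition ibin :: "int \<Rightarrow> nat \<Rightarrow> complex" where
  "ibin p i = (of_int p) gchoose i"

definition isign :: "int \<Rightarrow> complex" where
  "isign r = (if even r then 1 else -1)"

definition fin_dim :: "(complex \<Rightarrow> 'a::ab_group_add \<Rightarrow> 'a) \<Rightarrow> 'a set \<Rightarrow> bool" where
  "fin_dim s W \<longleftrightarrow> (\<exists>S. finite S \<and> S \<subseteq> W \<and> W \<subseteq> module.span s S)"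

definition cscale :: "complex \<Rightarrow> complex \<Rightarrow> complex" where
  "cscale c x = c * x"

definition borcherds ::
  "(complex \<Rightarrow> 'v::ab_group_add \<Rightarrow> 'v) \<Rightarrow> ('v \<Rightarrow> int \<Rightarrow> 'v \<Rightarrow> 'v) \<Rightarrow>
   (complex \<Rightarrow> 'm::ab_group_add \<Rightarrow> 'm) \<Rightarrow> ('v \<Rightarrow> int \<Rightarrow> 'm \<Rightarrow> 'm) \<Rightarrow> bool" where
  "borcherds sV Y sM Ym \<longleftrightarrow>
    (\<forall>a b c p q r.
      fsum (\<lambda>i::nat. sM (ibin p i) (Ym (Y a (r + int i) b) (p + q - int i) c))
    = fsum (\<lambda>i::nat. sM ((-1)^i * ibin r i)
            (Ym a (p + r - int i) (Ym b (q + int i) c)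
             - sM (isign r) (Ym b (q + r - int i) (Ym a (p + int i) c)))))"

text \<open>\<open>Y a n b\<close> is \<open>a_(n) b\<close>; \<open>L n = \<omega>_(n+1)\<close>.\<close>
definition Vdeg :: "(complex \<Rightarrow> 'v::ab_group_add \<Rightarrow> 'v) \<Rightarrow> ('v \<Rightarrow> int \<Rightarrow> 'v \<Rightarrow> 'v) \<Rightarrow> 'v
    \<Rightarrow> nat \<Rightarrow> 'v set" where
  "Vdeg sV Y om k = {a. Y om 1 a = sV (of_nat k) a}"

definition is_VOA :: "(complex \<Rightarrow> 'v::ab_group_add \<Rightarrow> 'v) \<Rightarrow> ('v \<Rightarrow> int \<Rightarrow> 'v \<Rightarrow> 'v)
    \<Rightarrow> 'v \<Rightarrow> 'v \<Rightarrow> bool" where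
  "is_VOA sV Y vac om \<longleftrightarrow>
    vector_space sV \<and>
    (\<forall>n b. Vector_Spaces.linear sV sV (\<lambda>a. Y a n b)) \<and>
    (\<forall>a n. Vector_Spaces.linear sV sV (Y a n)) \<and>
    (\<forall>a b. \<exists>N. \<forall>n\<ge>N. Y a n b = 0) \<and>
    (\<forall>n b. Y vac n b = (if n = -1 then b else 0)) \<and>
    (\<forall>a n. n \<ge> 0 \<longrightarrow> Y a n vac = 0) \<and>
    (\<forall>a. Y a (-1) vac = a) \<and>
    borcherds sV Y sV Y \<and>
    (\<exists>c::complex. \<forall>m n v.
       Y om (m + 1) (Y om (n + 1) v) - Y om (n + 1) (Y om (m + 1) v)
       = sV (of_int (m - n)) (Y om (m + n + 1) v)
         + (if m + n = 0 then sV ((of_int m ^ 3 - of_int m) / 12 * c) v else 0)) \<and>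
    (\<forall>a n. Y (Y om 0 a) n = (\<lambda>b. sV (- of_int n) (Y a (n - 1) b))) \<and>
    vac \<in> Vdeg sV Y om 0 \<and> om \<in> Vdeg sV Y om 2 \<and>
    (\<forall>k. fin_dim sV (Vdeg sV Y om k)) \<and>
    (\<forall>a. \<exists>f. finite {k. f k \<noteq> 0} \<and> (\<forall>k. f k \<in> Vdeg sV Y om k) \<and> a = sum f {k. f k \<noteq> 0})"

text \<open>Homogeneous components of an element of \<open>V\<close> (unique for a VOA).\<close>
definition vcomp :: "(complex \<Rightarrow> 'v::ab_group_add \<Rightarrow> 'v) \<Rightarrow> ('v \<Rightarrow> int \<Rightarrow> 'v \<Rightarrow> 'v) \<Rightarrow> 'v
    \<Rightarrow> 'v \<Rightarrow> nat \<Rightarrow> 'v" where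
  "vcomp sV Y om a = (SOME f. finite {k. f k \<noteq> 0} \<and> (\<forall>k. f k \<in> Vdeg sV Y om k)
                                \<and> a = sum f {k. f k \<noteq> 0})"

definition is_weak_module :: "(complex \<Rightarrow> 'v::ab_group_add \<Rightarrow> 'v) \<Rightarrow> ('v \<Rightarrow> int \<Rightarrow> 'v \<Rightarrow> 'v)
    \<Rightarrow> 'v \<Rightarrow> (complex \<Rightarrow> 'm::ab_group_add \<Rightarrow> 'm) \<Rightarrow> ('v \<Rightarrow> int \<Rightarrow> 'm \<Rightarrow> 'm) \<Rightarrow> bool" where
  "is_weak_module sV Y vac sM Ym \<longleftrightarrow>
    vector_space sM \<and>
    (\<forall>n u. Vector_Spaces.linear sV sM (\<lambda>a. Ym a n u)) \<and>
    (\<forall>a n. Vector_Spaces.linear sM sM (Ym a n)) \<and>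
    (\<forall>a u. \<exists>N. \<forall>n\<ge>N. Ym a n u = 0) \<and>
    (\<forall>n u. Ym vac n u = (if n = -1 then u else 0)) \<and>
    borcherds sV Y sM Ym"

definition gen_eig :: "(complex \<Rightarrow> 'm::ab_group_add \<Rightarrow> 'm) \<Rightarrow> ('v \<Rightarrow> int \<Rightarrow> 'm \<Rightarrow> 'm) \<Rightarrow> 'v
    \<Rightarrow> complex \<Rightarrow> nat \<Rightarrow> nat \<Rightarrow> 'm set" where
  "gen_eig sM Ym om h k n =
     {u. ((\<lambda>x. Ym om 1 x - sM (h + of_nat n) x) ^^ (k + 1)) u = 0}"

definition is_Ck_module :: "(complex \<Rightarrow> 'v::ab_group_add \<Rightarrow> 'v) \<Rightarrow> ('v \<Rightarrow> int \<Rightarrow> 'v \<Rightarrow> 'v)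
    \<Rightarrow> 'v \<Rightarrow> 'v \<Rightarrow> (complex \<Rightarrow> 'm::ab_group_add \<Rightarrow> 'm) \<Rightarrow> ('v \<Rightarrow> int \<Rightarrow> 'm \<Rightarrow> 'm)
    \<Rightarrow> complex \<Rightarrow> nat \<Rightarrow> bool" where
  "is_Ck_module sV Y vac om sM Ym h k \<longleftrightarrow>
    is_weak_module sV Y vac sM Ym \<and>
    (\<forall>u. \<exists>f. finite {n. f n \<noteq> 0} \<and> (\<forall>n. f n \<in> gen_eig sM Ym om h k n)
             \<and> u = sum f {n. f n \<noteq> 0}) \<and>
    (\<forall>n. fin_dim sM (gen_eig sM Ym om h k n))"

text \<open>For \<open>a \<in> V_k\<close>: \<open>theta(J_n(a)) u = (-1)^k \<Sum>_j 1/j! (L_1^j a)_(k-j-1-n) u\<close>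
  (since \<open>J_m(b) = b_(|b|-1+m)\<close> and \<open>|L_1^j a| = k - j\<close>).\<close>
definition theta_act :: "('v::ab_group_add \<Rightarrow> int \<Rightarrow> 'v \<Rightarrow> 'v) \<Rightarrow> 'v
    \<Rightarrow> (complex \<Rightarrow> 'm::ab_group_add \<Rightarrow> 'm) \<Rightarrow> ('v \<Rightarrow> int \<Rightarrow> 'm \<Rightarrow> 'm)
    \<Rightarrow> nat \<Rightarrow> 'v \<Rightarrow> int \<Rightarrow> 'm \<Rightarrow> 'm" where
  "theta_act Y om sM Ym k a n u =
     sM ((-1) ^ k) (fsum (\<lambda>j::nat. sM (1 / of_nat (fact j))
        (Ym ((Y om 2 ^^ j) a) (int k - int j - 1 - n) u)))"

text \<open>Restricted dual \<open>D(M) = \<Oplus>_n M_(h+n)^*\<close>, realised as the linear functionals on \<open>M\<close>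
  vanishing on all but finitely many \<open>M_(h+n)\<close>.\<close>
definition restricted_dual :: "(complex \<Rightarrow> 'm::ab_group_add \<Rightarrow> 'm) \<Rightarrow> ('v \<Rightarrow> int \<Rightarrow> 'm \<Rightarrow> 'm)
    \<Rightarrow> 'v \<Rightarrow> complex \<Rightarrow> nat \<Rightarrow> ('m \<Rightarrow> complex) set" where
  "restricted_dual sM Ym om h k =
     {\<phi>. Vector_Spaces.linear sM cscale \<phi> \<and>
          (\<exists>N. \<forall>n>N. \<forall>u\<in>gen_eig sM Ym om h k n. \<phi> u = 0)}"

text \<open>The V-module structure on \<open>D(M)\<close>: for \<open>a \<in> V_k\<close>, \<open>a_(m) = J_{m-k+1}(a)\<close>, so
  \<open><a_(m) phi, u> = <phi, theta(J_{m-k+1}(a)) u>\<close>; extended linearly in \<open>a\<close>.\<close>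
definition dual_act :: "(complex \<Rightarrow> 'v::ab_group_add \<Rightarrow> 'v) \<Rightarrow> ('v \<Rightarrow> int \<Rightarrow> 'v \<Rightarrow> 'v) \<Rightarrow> 'v
    \<Rightarrow> (complex \<Rightarrow> 'm::ab_group_add \<Rightarrow> 'm) \<Rightarrow> ('v \<Rightarrow> int \<Rightarrow> 'm \<Rightarrow> 'm)
    \<Rightarrow> 'v \<Rightarrow> int \<Rightarrow> ('m \<Rightarrow> complex) \<Rightarrow> ('m \<Rightarrow> complex)" where
  "dual_act sV Y om sM Ym a m \<phi> =
     (\<lambda>u. fsum (\<lambda>k. \<phi> (theta_act Y om sM Ym k (vcomp sV Y om a k) (m - int k + 1) u)))"

text \<open>An element \<open>f\<close> of \<open>C[z,z^-1,(z-1)^-1]\<close> is written \<open>f(z) = p(z) z^-\<alpha> (z-1)^-\<beta>\<close>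
  (every element has such a representation).  \<open>fexp Z p \<alpha> \<beta>\<close> substitutes the Laurent
  series \<open>Z\<close> for \<open>z\<close>.\<close>
definition fexp :: "complex fls \<Rightarrow> complex poly \<Rightarrow> nat \<Rightarrow> nat \<Rightarrow> complex fls" where
  "fexp Z p \<alpha> \<beta> = poly (map_poly fls_const p) Z * inverse Z ^ \<alpha> * inverse (Z - 1) ^ \<beta>"

definition exp0 :: "complex poly \<Rightarrow> nat \<Rightarrow> nat \<Rightarrow> int \<Rightarrow> complex" where
  "exp0 p \<alpha> \<beta> m = fls_nth (fexp fls_X p \<alpha> \<beta>) m"

definition exp1 :: "complex poly \<Rightarrow> nat \<Rightarrow> nat \<Rightarrow> int \<Rightarrow> complex" where
  "exp1 p \<alpha> \<beta> m = fls_nth (fexp (fls_X + 1) p \<alpha> \<beta>) m"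

text \<open>Expansion at \<open>\<infinity>\<close> in \<open>\<xi> = z\<close>, as a Laurent series in \<open>w = \<xi>^-1\<close>: coefficient of
  \<open>\<xi>^m\<close> is the coefficient of \<open>w^-m\<close>.\<close>
definition expinf :: "complex poly \<Rightarrow> nat \<Rightarrow> nat \<Rightarrow> int \<Rightarrow> complex" where
  "expinf p \<alpha> \<beta> m = fls_nth (fexp (inverse fls_X) p \<alpha> \<beta>) (- m)"

text \<open>\<open>C^*(M_A,p_A) = Hom(M_A / g^out M_A, C)\<close>, realised (universal property of the tensor
  product) as trilinear forms on \<open>M^1 \<times> M^2 \<times> M^3\<close> vanishing on the generators of
  \<open>g^out M_A\<close>.\<close>
definition conformal_blocks ::
  "(complex \<Rightarrow> 'v::ab_group_add \<Rightarrow> 'v) \<Rightarrow> ('v \<Rightarrow> int \<Rightarrow> 'v \<Rightarrow> 'v) \<Rightarrow> 'v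
   \<Rightarrow> (complex \<Rightarrow> 'm1::ab_group_add \<Rightarrow> 'm1) \<Rightarrow> ('v \<Rightarrow> int \<Rightarrow> 'm1 \<Rightarrow> 'm1)
   \<Rightarrow> (complex \<Rightarrow> 'm2::ab_group_add \<Rightarrow> 'm2) \<Rightarrow> ('v \<Rightarrow> int \<Rightarrow> 'm2 \<Rightarrow> 'm2)
   \<Rightarrow> (complex \<Rightarrow> 'm3::ab_group_add \<Rightarrow> 'm3) \<Rightarrow> ('v \<Rightarrow> int \<Rightarrow> 'm3 \<Rightarrow> 'm3)
   \<Rightarrow> ('m1 \<Rightarrow> 'm2 \<Rightarrow> 'm3 \<Rightarrow> complex) set" where
  "conformal_blocks sV Y om s1 Y1 s2 Y2 s3 Y3 =
    {\<Phi>. (\<forall>u2 u3. Vector_Spaces.linear s1 cscale (\<lambda>u1. \<Phi> u1 u2 u3)) \<and>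
         (\<forall>u1 u3. Vector_Spaces.linear s2 cscale (\<lambda>u2. \<Phi> u1 u2 u3)) \<and>
         (\<forall>u1 u2. Vector_Spaces.linear s3 cscale (\<lambda>u3. \<Phi> u1 u2 u3)) \<and>
         (\<forall>k a p \<alpha> \<beta> u1 u2 u3. a \<in> Vdeg sV Y om k \<longrightarrow>
            \<Phi> (fsum (\<lambda>m. s1 (exp0 p \<alpha> \<beta> m) (Y1 a m u1))) u2 u3
          + \<Phi> u1 (fsum (\<lambda>m. s2 (exp1 p \<alpha> \<beta> m) (Y2 a m u2))) u3
          + \<Phi> u1 u2 (- fsum (\<lambda>n. s3 (expinf p \<alpha> \<beta> (n + int k - 1))
                                     (theta_act Y om s3 Y3 k a n u3))) = 0)}"

text \<open>Logarithmic intertwining operators of type \<open>(D(M^3); M^2 M^1)\<close>: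
  \<open>I n \<alpha> u2 u1 = (u2)^n_(\<alpha>) u1 \<in> D(M^3)\<close>, the coefficient of \<open>z^(-\<alpha>-1) (log z)^n\<close>.\<close>
definition log_intertwiners ::
  "(complex \<Rightarrow> 'v::ab_group_add \<Rightarrow> 'v) \<Rightarrow> ('v \<Rightarrow> int \<Rightarrow> 'v \<Rightarrow> 'v) \<Rightarrow> 'v
   \<Rightarrow> (complex \<Rightarrow> 'm1::ab_group_add \<Rightarrow> 'm1) \<Rightarrow> ('v \<Rightarrow> int \<Rightarrow> 'm1 \<Rightarrow> 'm1)
   \<Rightarrow> (complex \<Rightarrow> 'm2::ab_group_add \<Rightarrow> 'm2) \<Rightarrow> ('v \<Rightarrow> int \<Rightarrow> 'm2 \<Rightarrow> 'm2)
   \<Rightarrow> (complex \<Rightarrow> 'm3::ab_group_add \<Rightarrow> 'm3) \<Rightarrow> ('v \<Rightarrow> int \<Rightarrow> 'm3 \<Rightarrow> 'm3)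
   \<Rightarrow> complex \<Rightarrow> nat
   \<Rightarrow> (nat \<Rightarrow> complex \<Rightarrow> 'm2 \<Rightarrow> 'm1 \<Rightarrow> 'm3 \<Rightarrow> complex) set" where
  "log_intertwiners sV Y om s1 Y1 s2 Y2 s3 Y3 h3 k3 =
    {I. (\<exists>d. \<forall>n>d. \<forall>\<alpha>. I n \<alpha> = (\<lambda>u2 u1 u3. 0)) \<and>
        (\<forall>n \<alpha> u2 u1. I n \<alpha> u2 u1 \<in> restricted_dual s3 Y3 om h3 k3) \<and>
        (\<forall>n \<alpha> u2. Vector_Spaces.linear s1 (\<lambda>c f x. c * f x) (I n \<alpha> u2)) \<and>
        (\<forall>n \<alpha>. Vector_Spaces.linear s2 (\<lambda>c f x y. c * f x y) (I n \<alpha>)) \<and>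
        (\<forall>u2 u1 n. \<exists>R. \<forall>\<alpha>. Re \<alpha> > R \<longrightarrow> I n \<alpha> u2 u1 = 0) \<and>
        (\<forall>n \<alpha> u2. I n \<alpha> (Y2 om 0 u2)
            = (\<lambda>u1 u3. - \<alpha> * I n (\<alpha> - 1) u2 u1 u3
                         + of_nat (n + 1) * I (n + 1) (\<alpha> - 1) u2 u1 u3)) \<and>
        (\<forall>a u2 u1 \<alpha> n p q u3.
            fsum (\<lambda>i::nat. (ibin p i *
                 I n (\<alpha> + of_int p - of_nat i) (Y2 a (q + int i) u2) u1 u3))
          = fsum (\<lambda>i::nat. ((-1) ^ i * ibin q i *
                 (dual_act sV Y om s3 Y3 a (p + q - int i) (I n (\<alpha> + of_nat i) u2 u1) u3
                  - isign q * I n (\<alpha> + of_int q - of_nat i) u2 (Y1 a (p + int i) u1) u3))))}"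

end

theory Submission
  imports Defs
begin

text \<open>
  For a trilinear form \<open>\<Phi>\<close> put \<open>(T \<Phi>)(u1, u2, u3) = \<Phi>(L0 u1, u2, u3) + \<Phi>(u1, L0 u2, u3) - \<Phi>(u1, u2, L0 u3)\<close>.
  On generalised \<open>L0\<close>-eigenvectors with eigenvalues \<open>l1, l2, l3\<close> the operator \<open>T - (l1 + l2 - l3)\<close> is
  nilpotent, so \<open>\<Phi>\<close> splits into components \<open>\<Phi>_w\<close> of weight \<open>w = l1 + l2 - l3\<close>.  A conformal block \<open>\<Phi>\<close>
  corresponds to \<open>\<langle>I(u2, z) u1, u3\<rangle> = \<Phi>(z^(-L0) u1, z^(-L0) u2, z^(L0) u3)\<close>, and \<open>\<Phi>\<close> is recovered by
  setting \<open>z = 1\<close>, \<open>log z = 0\<close>, that is by summing the coefficients of \<open>(log z)^0\<close>.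

  Rational functions with poles in \<open>{0, 1, \<infinity>}\<close> are spanned by \<open>z^p (z - 1)^q\<close> with integers \<open>p, q\<close>, and
  expanding these functions at the three points turns invariance of \<open>\<Phi>\<close> into the Borcherds-type identity
  for \<open>I\<close> summed over all exponents.  Since \<open>a_(m)\<close> shifts weights by a constant, the identity for the sum is
  equivalent to the identities for the separate components.  For \<open>a = \<omega>, p = 1, q = 0\<close> the identity converts
  the \<open>L_(-1)\<close>-axiom into \<open>(T - \<alpha> - 1) I^n_\<alpha> = - (n + 1) I^(n+1)_\<alpha>\<close>; hence \<open>T - \<alpha> - 1\<close> is nilpotent on
  \<open>I^0_\<alpha>\<close>, which therefore lives in weight \<open>\<alpha> + 1\<close> and determines all \<open>I^n_\<alpha>\<close>.
\<close>

section \<open>Finite sums and generalised eigenspaces\<close>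

lemma fsum_eq_sum:
  assumes "finite A" "\<And>i. i \<notin> A \<Longrightarrow> g i = 0"
  shows "fsum g = sum g A"
  unfolding fsum_def by (rule sum.mono_neutral_left) (use assms in auto)

lemma fsum_zero [simp]: "fsum (\<lambda>i. 0) = 0"
  by (simp add: fsum_def)

lemma fsum_delta [simp]: "fsum (\<lambda>i. if i = j then c else 0) = c"
  by (subst fsum_eq_sum[of "{j}"]) auto

lemma finite_support_add:
  fixes f g :: "'i \<Rightarrow> 'a::comm_monoid_add"
  assumes "finite {i. f i \<noteq> 0}" "finite {i. g i \<noteq> 0}"
  shows "finite {i. f i + g i \<noteq> 0}"
  by (rule finite_subset[OF _ finite_UnI[OF assms]]) auto

lemma fsum_add:
  assumes "finite {i. f i \<noteq> 0}" "finite {i. g i \<noteq> 0}"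
  shows "fsum (\<lambda>i. f i + g i) = fsum f + fsum g"
proof -
  let ?A = "{i. f i \<noteq> 0} \<union> {i. g i \<noteq> 0}"
  have "finite ?A" using assms by blast
  then have "fsum f = sum f ?A" "fsum g = sum g ?A" "fsum (\<lambda>i. f i + g i) = sum (\<lambda>i. f i + g i) ?A"
    by (auto intro!: fsum_eq_sum)
  then show ?thesis by (simp add: sum.distrib)
qed

lemma fsum_additive:
  assumes "\<And>x y. F (x + y) = F x + F y" "F 0 = 0" "finite {i. g i \<noteq> 0}"
  shows "F (fsum g) = fsum (\<lambda>i. F (g i))"
proof -
  have "F (sum g A) = sum (\<lambda>i. F (g i)) A" if "finite A" for A
    using that by induction (auto simp: assms)
  then have "F (fsum g) = sum (\<lambda>i. F (g i)) {i. g i \<noteq> 0}"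
    using assms(3) by (simp add: fsum_def)
  then show ?thesis using assms(3)
    by (subst fsum_eq_sum[of "{i. g i \<noteq> 0}"]) (auto simp: assms(2))
qed

lemma fsum_mult: 
  fixes g :: "'i \<Rightarrow> complex"
  shows "fsum (\<lambda>i. c * g i) = c * fsum g"
  by (cases "c = 0") (auto simp: fsum_def sum_distrib_left)

lemma fsum_diff:
  fixes f :: "'i \<Rightarrow> complex"
  assumes "finite {i. f i \<noteq> 0}" "finite {i. g i \<noteq> 0}"
  shows "fsum (\<lambda>i. f i - g i) = fsum f - fsum g"
  using fsum_add[of f "\<lambda>i. (-1) * g i"] fsum_mult[of "-1" g] assms by simp

lemma fsum_sum:
  assumes "finite A" "\<And>j. j \<in> A \<Longrightarrow> finite {i. g j i \<noteq> 0}"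
  shows "fsum (\<lambda>i. \<Sum>j\<in>A. g j i) = (\<Sum>j\<in>A. fsum (g j))"
proof -
  let ?B = "\<Union>j\<in>A. {i. g j i \<noteq> 0}"
  have B: "finite ?B" using assms by blast
  have "fsum (\<lambda>i. \<Sum>j\<in>A. g j i) = (\<Sum>i\<in>?B. \<Sum>j\<in>A. g j i)"
    by (rule fsum_eq_sum[OF B]) (auto intro: sum.neutral)
  also have "\<dots> = (\<Sum>j\<in>A. \<Sum>i\<in>?B. g j i)" by (rule sum.swap)
  also have "\<dots> = (\<Sum>j\<in>A. fsum (g j))"
    by (intro sum.cong refl, subst fsum_eq_sum[OF B]) auto
  finally show ?thesis .
qed

lemma fsum_reindex_inj:
  assumes "inj h" "\<And>m. m \<notin> range h \<Longrightarrow> g m = 0"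
  shows "fsum g = fsum (\<lambda>i. g (h i))"
proof -
  have "{m. g m \<noteq> 0} = h ` {i. g (h i) \<noteq> 0}" using assms(2) by fastforce
  then show ?thesis using assms(1)
    by (simp add: fsum_def sum.reindex inj_on_subset[OF assms(1)])
qed

lemma finite_nat_support: "(\<And>i. i \<ge> N \<Longrightarrow> f i = 0) \<Longrightarrow> finite {i::nat. f i \<noteq> 0}"
  by (rule finite_subset[of _ "{..<N}"]) (auto simp: not_le[symmetric])

lemma finite_int_support:
  assumes "\<And>m. m < N \<Longrightarrow> f m = 0" "\<And>m. m > N' \<Longrightarrow> f m = 0"
  shows "finite {m::int. f m \<noteq> 0}"
proof (rule finite_subset)
  show "{m. f m \<noteq> 0} \<subseteq> {N..N'}" using assms by (force simp: not_less[symmetric])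
qed simp

lemma vector_space_cscale: "vector_space cscale"
  by unfold_locales (auto simp: cscale_def algebra_simps)

section \<open>Generalised eigenspaces and their independence\<close>

definition gen_eigenspace ::
  "(complex \<Rightarrow> 'm::ab_group_add \<Rightarrow> 'm) \<Rightarrow> ('m \<Rightarrow> 'm) \<Rightarrow> nat \<Rightarrow> complex \<Rightarrow> 'm set" where
  "gen_eigenspace s L K l = {u. ((\<lambda>x. L x - s l x) ^^ K) u = 0}"

text \<open>\<open>K\<close> is the nilpotency order itself: it becomes \<open>Suc 0\<close> for the
  algebra, where L_0 is diagonalisable, and \<open>Suc k\<close> for a module in C_k. The locale
  asks that every vector decomposes; uniqueness of the decomposition comes from
  \<open>ge_independent\<close>.\<close>

locale graded_space = vector_space s
  for s :: "complex \<Rightarrow> 'm::ab_group_add \<Rightarrow> 'm" +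
  fixes L :: "'m \<Rightarrow> 'm" and h :: complex and K :: nat
  assumes L_linear: "Vector_Spaces.linear s s L"
    and decomposition: "\<exists>f. finite {n. f n \<noteq> 0} \<and>
      (\<forall>n. f n \<in> gen_eigenspace s L K (h + of_nat n)) \<and> u = sum f {n. f n \<noteq> 0}"
begin

abbreviation "nil l x \<equiv> L x - s l x"
abbreviation "ge \<equiv> gen_eigenspace s L K"

lemma L_add: "L (x + y) = L x + L y" and L_scale: "L (s c x) = s c (L x)"
  using L_linear unfolding Vector_Spaces.linear_iff by blast+

lemma L_zero [simp]: "L 0 = 0"
  using L_scale[of 0 0] by simp

lemma L_diff: "L (x - y) = L x - L y"
  using L_add[of "x - y" y] by (simp add: algebra_simps)

lemma nil_pow_add: "(nil l ^^ n) (x + y) = (nil l ^^ n) x + (nil l ^^ n) y"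
  by (induction n) (auto simp: L_add scale_right_distrib)

lemma nil_pow_scale: "(nil l ^^ n) (s c x) = s c ((nil l ^^ n) x)"
  by (induction n) (auto simp: L_scale scale_right_diff_distrib mult.commute)

lemma nil_pow_zero [simp]: "(nil l ^^ n) 0 = 0"
  by (induction n) auto

lemma nil_pow_sum: "(nil l ^^ n) (sum f A) = (\<Sum>a\<in>A. (nil l ^^ n) (f a))"
  by (induction A rule: infinite_finite_induct) (auto simp: nil_pow_add)

lemma nil_commute: "nil l (nil m x) = nil m (nil l x)"
  by (simp add: L_diff L_scale scale_right_diff_distrib mult.commute)

lemma nil_pow_commute: "(nil l ^^ n) (nil m x) = nil m ((nil l ^^ n) x)"
proof (induction n)
  case (Suc n)
  then show ?case using nil_commute[where l = l and m = m] by simp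
qed simp

lemma nil_pow_pow_commute: "(nil l ^^ n) ((nil m ^^ k) x) = (nil m ^^ k) ((nil l ^^ n) x)"
  by (induction k) (simp_all only: funpow.simps id_apply o_apply nil_pow_commute)

lemma ge_add: "x \<in> ge l \<Longrightarrow> y \<in> ge l \<Longrightarrow> x + y \<in> ge l"
  and ge_scale: "x \<in> ge l \<Longrightarrow> s c x \<in> ge l"
  and ge_zero [simp]: "0 \<in> ge l"
  by (auto simp: gen_eigenspace_def nil_pow_add nil_pow_scale)

lemma nil_pow_ge: "x \<in> ge l \<Longrightarrow> (nil m ^^ n) x \<in> ge l"
  by (simp add: gen_eigenspace_def nil_pow_pow_commute[where l = l])

lemma L_ge: "x \<in> ge l \<Longrightarrow> L x \<in> ge l"
  using ge_add[OF nil_pow_ge[where n = 1 and m = l] ge_scale[of x l l], of x] by simp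

lemma nil_pow_eigenvector:
  assumes "L u = s l u" shows "(nil m ^^ n) u = s ((l - m) ^ n) u"
  by (induction n) (auto simp: L_scale assms algebra_simps scale_left_diff_distrib)

text \<open>The polynomials (x - l)^a and (x - m)^b are coprime. Concretely, the induction
  hypothesis applied to \<open>nil l u\<close> makes \<open>u\<close> an eigenvector for l, on which
  the power of \<open>nil m\<close> is the nonzero scalar (l - m)^b.\<close>

lemma coprime_zero:
  assumes "l \<noteq> m"
  shows "(nil l ^^ a) u = 0 \<Longrightarrow> (nil m ^^ b) u = 0 \<Longrightarrow> u = 0"
proof (induction a arbitrary: u)
  case (Suc a)
  have "nil l u = 0"
  proof (rule Suc.IH)
    show "(nil l ^^ a) (nil l u) = 0"
      using Suc.prems(1) by (simp only: funpow_Suc_right o_apply)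
    have "(nil m ^^ b) (nil l u) = nil l ((nil m ^^ b) u)" by (rule nil_pow_commute)
    then show "(nil m ^^ b) (nil l u) = 0" by (simp only: Suc.prems(2)) simp
  qed
  then have "(nil m ^^ b) u = s ((l - m) ^ b) u" by (intro nil_pow_eigenvector) simp
  then show ?case using Suc.prems(2) assms by simp
qed simp

lemma ge_disjoint: "u \<in> ge l \<Longrightarrow> u \<in> ge m \<Longrightarrow> l \<noteq> m \<Longrightarrow> u = 0"
  using coprime_zero unfolding gen_eigenspace_def by blast

text \<open>The K-th power of L - m removes the summand of eigenvalue m and preserves every other
  eigenspace. By induction the remaining summands are killed by it, so they lie in the eigenspace of
  m as well and vanish by \<open>ge_disjoint\<close>.\<close>

lemma ge_independent:
  assumes "finite S" "\<And>l. l \<in> S \<Longrightarrow> g l \<in> ge l" "sum g S = 0" "l \<in> S"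
  shows "g l = 0"
  using assms
proof (induction S arbitrary: g l)
  case (insert m S)
  have z: "(nil m ^^ K) (g m) = 0"
    using insert.prems(1)[of m] by (simp add: gen_eigenspace_def)
  have "(nil m ^^ K) (g m + sum g S) = 0"
    using insert.prems(2) insert.hyps by simp
  then have sum0: "(\<Sum>l\<in>S. (nil m ^^ K) (g l)) = 0"
    by (simp only: nil_pow_add nil_pow_sum z) simp
  have S: "g l = 0" if "l \<in> S" for l
  proof -
    have "(nil m ^^ K) (g l) = 0"
      by (rule insert.IH[of "\<lambda>l. (nil m ^^ K) (g l)", OF _ sum0 that])
        (use insert.prems in \<open>auto intro: nil_pow_ge\<close>)
    then have "g l \<in> ge m" by (simp add: gen_eigenspace_def)
    then show ?thesis using insert.prems(1)[of l] ge_disjoint[of "g l" l m] that insert.hyps by auto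
  qed
  moreover have "g m = 0" using insert.prems(2) insert.hyps S by simp
  ultimately show ?case using insert.prems by auto
qed simp

section \<open>Weight components of a vector\<close>

definition decomp :: "'m \<Rightarrow> (complex \<Rightarrow> 'm) \<Rightarrow> bool" where
  "decomp u f \<longleftrightarrow> finite {l. f l \<noteq> 0} \<and> (\<forall>l. f l \<in> ge l) \<and> u = sum f {l. f l \<noteq> 0}"

lemma decomp_unique:
  assumes "decomp u f" "decomp u g" shows "f = g"
proof
  fix l
  let ?S = "{l. f l \<noteq> 0} \<union> {l. g l \<noteq> 0}"
  have S: "finite ?S" using assms by (auto simp: decomp_def)
  have "u = sum f ?S" "u = sum g ?S"
    using assms fsum_eq_sum[OF S, of f] fsum_eq_sum[OF S, of g] by (auto simp: decomp_def fsum_def)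
  then have "(\<Sum>l\<in>?S. f l - g l) = 0" by (simp add: sum_subtractf)
  moreover have "f l - g l \<in> ge l" for l
    using assms ge_add[of "f l" l "s (-1) (g l)"] ge_scale[of "g l" l "-1"] by (simp add: decomp_def)
  ultimately have "f l - g l = 0" if "l \<in> ?S"
    using ge_independent[OF S, of "\<lambda>l. f l - g l" l] that by simp
  then show "f l = g l" by (cases "l \<in> ?S") auto
qed

text \<open>Besides existence this records that the support lies in h + N, which later feeds the
  bounds of \<open>concentrated_bound\<close>.\<close>

lemma decomp_ex: "\<exists>f. decomp u f \<and> (\<forall>l. f l \<noteq> 0 \<longrightarrow> (\<exists>n. l = h + of_nat n))"
proof -
  obtain f where f: "finite {n. f n \<noteq> 0}" "\<And>n. f n \<in> ge (h + of_nat n)" "u = sum f {n. f n \<noteq> 0}"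
    using decomposition[of u] by blast
  let ?j = "\<lambda>n::nat. h + of_nat n"
  have inj: "inj ?j" by (auto simp: inj_def)
  define g where "g l = (if l \<in> range ?j then f (inv ?j l) else 0)" for l
  have gj: "g (?j n) = f n" for n using inv_f_f[OF inj, of n] by (simp add: g_def)
  have supp: "{l. g l \<noteq> 0} = ?j ` {n. f n \<noteq> 0}"
    using gj by (auto simp: g_def image_iff split: if_splits)
  have "sum g {l. g l \<noteq> 0} = u"
    unfolding supp using f(3) gj by (simp add: sum.reindex inj_on_subset[OF inj])
  moreover have "g l \<in> ge l" for l
    using f(2) gj by (cases "l \<in> range ?j") (force, simp add: g_def)
  ultimately have "decomp u g" using supp f(1) by (simp add: decomp_def)
  moreover have "g l \<noteq> 0 \<longrightarrow> (\<exists>n. l = h + of_nat n)" for l by (auto simp: g_def split: if_splits)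
  ultimately show ?thesis by blast
qed

text \<open>The index is an eigenvalue and not a degree. This gives the components in all three
  modules a common index set, so that a weight such as l1 + l2 - w can be used even where no
  eigenvalue occurs; the component there is 0.\<close>

definition pr :: "complex \<Rightarrow> 'm \<Rightarrow> 'm" where
  "pr l u = (THE f. decomp u f) l"

lemma decomp_pr: "decomp u (\<lambda>l. pr l u)"
proof -
  have "\<exists>!f. decomp u f" using decomp_ex decomp_unique by blast
  then have "decomp u (THE f. decomp u f)" by (rule theI')
  then show ?thesis by (simp add: pr_def)
qed

lemma pr_eqI: "decomp u f \<Longrightarrow> pr l u = f l"
  using decomp_unique[OF decomp_pr] by metis

lemma finite_pr: "finite {l. pr l u \<noteq> 0}"
  and pr_ge: "pr l u \<in> ge l"
  and sum_pr: "u = (\<Sum>l | pr l u \<noteq> 0. pr l u)"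
  using decomp_pr[of u] by (auto simp: decomp_def)

lemma pr_weight: "pr l u \<noteq> 0 \<Longrightarrow> \<exists>n. l = h + of_nat n"
  using decomp_ex[of u] pr_eqI by metis

lemma pr_ge_eq: "u \<in> ge m \<Longrightarrow> pr l u = (if l = m then u else 0)"
proof (rule pr_eqI)
  assume u: "u \<in> ge m"
  have "finite {l. (if l = m then u else 0) \<noteq> 0}" by (rule finite_subset[of _ "{m}"]) auto
  moreover have "sum (\<lambda>l. if l = m then u else 0) {l. (if l = m then u else 0) \<noteq> 0} = u"
    by (cases "u = 0") auto
  ultimately show "decomp u (\<lambda>l. if l = m then u else 0)" using u by (auto simp: decomp_def)
qed

lemma ge_weight: "u \<in> ge l \<Longrightarrow> u \<noteq> 0 \<Longrightarrow> \<exists>n. l = h + of_nat n"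
  using pr_weight[of l u] by (simp add: pr_ge_eq)

lemma pr_add: "pr l (x + y) = pr l x + pr l y"
proof (rule pr_eqI)
  let ?f = "\<lambda>l. pr l x + pr l y"
  have "fsum ?f = x + y"
    using sum_pr[of x] sum_pr[of y] by (simp add: fsum_add finite_pr fsum_def[of "\<lambda>l. pr l _"])
  then show "decomp (x + y) ?f"
    using finite_support_add[OF finite_pr finite_pr] by (simp add: decomp_def fsum_def ge_add pr_ge)
qed

lemma pr_scale: "pr l (s c x) = s c (pr l x)"
proof (cases "c = 0")
  case True
  then show ?thesis using pr_ge_eq[of 0 0 l] by simp
next
  case False
  then have "decomp (s c x) (\<lambda>l. s c (pr l x))"
    using sum_pr[of x] by (simp add: decomp_def finite_pr ge_scale pr_ge scale_sum_right[symmetric])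
  then show ?thesis by (rule pr_eqI)
qed

text \<open>The condition is the commutator relation [L, B] = c B, so \<open>B\<close> is an
  operator of weight \<open>c\<close>.\<close>

definition shifts :: "('m \<Rightarrow> 'm) \<Rightarrow> complex \<Rightarrow> bool" where
  "shifts B c \<longleftrightarrow> Vector_Spaces.linear s s B \<and> (\<forall>u. L (B u) = B (L u) + s c (B u))"

text \<open>The relation reads (L - l - c) B = B (L - l), and this carries over to all
  powers.\<close>

lemma shifts_ge: "shifts B c \<Longrightarrow> u \<in> ge l \<Longrightarrow> B u \<in> ge (l + c)"
proof -
  assume B: "shifts B c" and u: "u \<in> ge l"
  have Bl: "B (x - y) = B x - B y" "B (s c x) = s c (B x)" for x y c
    using B by (auto simp: shifts_def Vector_Spaces.linear_iff) (metis diff_add_cancel add_diff_cancel)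
  have "nil (l + c) (B x) = B (nil l x)" for x
    using B by (simp add: shifts_def Bl algebra_simps scale_left_distrib)
  then have "(nil (l + c) ^^ n) (B u) = B ((nil l ^^ n) u)" for n
    by (induction n) auto
  moreover have "B 0 = 0" using Bl(2)[of 0 0] by simp
  ultimately show ?thesis using u by (simp add: gen_eigenspace_def)
qed

end

context graded_space
begin

lemma shifts_scale: "shifts B c \<Longrightarrow> shifts (\<lambda>u. s r (B u)) c"
  by (auto simp: shifts_def Vector_Spaces.linear_iff scale_right_distrib L_scale scale_left_commute)

lemma shifts_sum: "(\<And>j. j \<in> A \<Longrightarrow> shifts (B j) c) \<Longrightarrow> shifts (\<lambda>u. \<Sum>j\<in>A. B j u) c"
proof (induction A rule: infinite_finite_induct)
  case (insert j A)
  then have "shifts (B j) c" "shifts (\<lambda>u. \<Sum>j\<in>A. B j u) c" by auto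
  then show ?case using insert.hyps
    by (auto simp: shifts_def Vector_Spaces.linear_iff scale_right_distrib L_add)
qed (auto simp: shifts_def Vector_Spaces.linear_iff vector_space_axioms)

end

section \<open>Linear forms tested on generalised eigenvectors\<close>

definition lin_form :: "(complex \<Rightarrow> 'm::ab_group_add \<Rightarrow> 'm) \<Rightarrow> ('m \<Rightarrow> complex) \<Rightarrow> bool" where
  "lin_form s f \<longleftrightarrow> (\<forall>x y. f (x + y) = f x + f y) \<and> (\<forall>c x. f (s c x) = c * f x)"

context graded_space
begin

lemma linear_cscale: "Vector_Spaces.linear s cscale f \<longleftrightarrow> lin_form s f"
  using vector_space_axioms vector_space_cscale
  unfolding Vector_Spaces.linear_iff lin_form_def cscale_def by blast

lemma lin_form_zero: "lin_form s f \<Longrightarrow> f 0 = 0"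
  using scale_zero_left[of 0] unfolding lin_form_def by (metis mult_zero_left)

lemma lin_form_diff: "lin_form s f \<Longrightarrow> f (x - y) = f x - f y"
  unfolding lin_form_def by (metis add_diff_cancel diff_add_cancel)

lemma lin_form_minus: "lin_form s f \<Longrightarrow> f (- x) = - f x"
  using lin_form_diff[of f 0 x] lin_form_zero[of f] by simp

lemma lin_form_sum: "lin_form s f \<Longrightarrow> f (sum g A) = (\<Sum>a\<in>A. f (g a))"
  by (induction A rule: infinite_finite_induct) (auto simp: lin_form_zero, simp add: lin_form_def)

lemma lin_form_fsum: "lin_form s f \<Longrightarrow> finite {i. g i \<noteq> 0} \<Longrightarrow> f (fsum g) = fsum (\<lambda>i. f (g i))"
  by (rule fsum_additive) (auto simp: lin_form_zero, simp add: lin_form_def)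

lemma lin_form_pr: "lin_form s f \<Longrightarrow> f u = (\<Sum>l | pr l u \<noteq> 0. f (pr l u))"
  by (subst sum_pr[of u]) (rule lin_form_sum)

lemma lin_form_nonzero: "lin_form s f \<Longrightarrow> f u \<noteq> 0 \<Longrightarrow> \<exists>l. pr l u \<noteq> 0 \<and> f (pr l u) \<noteq> 0"
proof -
  assume "lin_form s f" "f u \<noteq> 0"
  then have "(\<Sum>l | pr l u \<noteq> 0. f (pr l u)) \<noteq> 0" using lin_form_pr by metis
  then show ?thesis by (rule sum.not_neutral_contains_not_neutral) auto
qed

lemma lin_form_eqI:
  assumes "lin_form s f" "lin_form s g" "\<And>l u. u \<in> ge l \<Longrightarrow> f u = g u"
  shows "f u = g u"
  unfolding lin_form_pr[OF assms(1), of u] lin_form_pr[OF assms(2), of u]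
  by (intro sum.cong refl) (use assms(3) pr_ge in blast)

end

section \<open>Trilinear forms on graded spaces\<close>

locale graded_triple =
  M1: graded_space s1 L1 h1 K1 + M2: graded_space s2 L2 h2 K2 + M3: graded_space s3 L3 h3 K3
  for s1 :: "complex \<Rightarrow> 'm1::ab_group_add \<Rightarrow> 'm1" and L1 h1 K1
    and s2 :: "complex \<Rightarrow> 'm2::ab_group_add \<Rightarrow> 'm2" and L2 h2 K2
    and s3 :: "complex \<Rightarrow> 'm3::ab_group_add \<Rightarrow> 'm3" and L3 h3 K3
begin

definition trilinear :: "('m1 \<Rightarrow> 'm2 \<Rightarrow> 'm3 \<Rightarrow> complex) \<Rightarrow> bool" where
  "trilinear \<Phi> \<longleftrightarrow> (\<forall>u2 u3. lin_form s1 (\<lambda>u1. \<Phi> u1 u2 u3)) \<and>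
    (\<forall>u1 u3. lin_form s2 (\<lambda>u2. \<Phi> u1 u2 u3)) \<and> (\<forall>u1 u2. lin_form s3 (\<Phi> u1 u2))"

lemma trilinearI:
  assumes "\<And>u2 u3. lin_form s1 (\<lambda>u1. \<Phi> u1 u2 u3)" "\<And>u1 u3. lin_form s2 (\<lambda>u2. \<Phi> u1 u2 u3)"
    "\<And>u1 u2. lin_form s3 (\<Phi> u1 u2)"
  shows "trilinear \<Phi>"
  using assms by (simp add: trilinear_def)

lemma
  assumes "trilinear \<Phi>"
  shows trilinear1: "lin_form s1 (\<lambda>u1. \<Phi> u1 u2 u3)"
    and trilinear2: "lin_form s2 (\<lambda>u2. \<Phi> u1 u2 u3)"
    and trilinear3: "lin_form s3 (\<Phi> u1 u2)"
  using assms by (auto simp: trilinear_def)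

lemma trilinear_zeros:
  assumes "trilinear \<Phi>"
  shows "\<Phi> 0 u2 u3 = 0" "\<Phi> u1 0 u3 = 0" "\<Phi> u1 u2 0 = 0"
  using M1.lin_form_zero[OF trilinear1[OF assms]] M2.lin_form_zero[OF trilinear2[OF assms]]
    M3.lin_form_zero[OF trilinear3[OF assms]] by auto

lemma trilinear_add:
  assumes "trilinear \<Phi>"
  shows "\<Phi> (x1 + y1) u2 u3 = \<Phi> x1 u2 u3 + \<Phi> y1 u2 u3"
    "\<Phi> u1 (x2 + y2) u3 = \<Phi> u1 x2 u3 + \<Phi> u1 y2 u3"
    "\<Phi> u1 u2 (x3 + y3) = \<Phi> u1 u2 x3 + \<Phi> u1 u2 y3"
  using assms unfolding trilinear_def lin_form_def by blast+

lemma trilinear_scale: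
  assumes "trilinear \<Phi>"
  shows "\<Phi> (s1 c u1) u2 u3 = c * \<Phi> u1 u2 u3" "\<Phi> u1 (s2 c u2) u3 = c * \<Phi> u1 u2 u3"
    "\<Phi> u1 u2 (s3 c u3) = c * \<Phi> u1 u2 u3"
  using assms unfolding trilinear_def lin_form_def by blast+

lemma trilinear_diff:
  assumes "trilinear \<Phi>"
  shows "\<Phi> (x1 - y1) u2 u3 = \<Phi> x1 u2 u3 - \<Phi> y1 u2 u3"
    "\<Phi> u1 (x2 - y2) u3 = \<Phi> u1 x2 u3 - \<Phi> u1 y2 u3"
    "\<Phi> u1 u2 (x3 - y3) = \<Phi> u1 u2 x3 - \<Phi> u1 u2 y3"
  using M1.lin_form_diff[OF trilinear1[OF assms]] M2.lin_form_diff[OF trilinear2[OF assms]]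
    M3.lin_form_diff[OF trilinear3[OF assms]] by auto

lemma trilinear_lincomb:
  "trilinear \<Phi> \<Longrightarrow> trilinear \<Psi> \<Longrightarrow> trilinear (\<lambda>u1 u2 u3. a * \<Phi> u1 u2 u3 + b * \<Psi> u1 u2 u3)"
  by (auto simp: trilinear_def lin_form_def algebra_simps)

text \<open>The arguments are decomposed one at a time. This reduces the identities between forms
  below to homogeneous triples.\<close>

lemma trilinear_eqI:
  assumes "trilinear \<Phi>" "trilinear \<Psi>"
    and "\<And>l1 l2 l3 u1 u2 u3. u1 \<in> M1.ge l1 \<Longrightarrow> u2 \<in> M2.ge l2 \<Longrightarrow> u3 \<in> M3.ge l3 \<Longrightarrow>
      \<Phi> u1 u2 u3 = \<Psi> u1 u2 u3"
  shows "\<Phi> = \<Psi>"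
proof -
  have 3: "\<Phi> u1 u2 u3 = \<Psi> u1 u2 u3" if "u1 \<in> M1.ge l1" "u2 \<in> M2.ge l2" for u1 u2 u3 l1 l2
    by (rule M3.lin_form_eqI[OF trilinear3[OF assms(1)] trilinear3[OF assms(2)]])
      (use assms(3) that in blast)
  have 2: "\<Phi> u1 u2 u3 = \<Psi> u1 u2 u3" if "u1 \<in> M1.ge l1" for u1 u2 u3 l1
    by (rule M2.lin_form_eqI[OF trilinear2[OF assms(1)] trilinear2[OF assms(2)]])
      (use 3 that in blast)
  have "\<Phi> u1 u2 u3 = \<Psi> u1 u2 u3" for u1 u2 u3
    by (rule M1.lin_form_eqI[OF trilinear1[OF assms(1)] trilinear1[OF assms(2)]])
      (use 2 in blast)
  then show ?thesis by blast
qed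

section \<open>The operator T - w on trilinear forms and its nilpotency\<close>

definition weight_op :: "complex \<Rightarrow> ('m1 \<Rightarrow> 'm2 \<Rightarrow> 'm3 \<Rightarrow> complex) \<Rightarrow> 'm1 \<Rightarrow> 'm2 \<Rightarrow> 'm3 \<Rightarrow> complex" where
  "weight_op w \<Phi> = (\<lambda>u1 u2 u3. \<Phi> (L1 u1) u2 u3 + \<Phi> u1 (L2 u2) u3 - \<Phi> u1 u2 (L3 u3) - w * \<Phi> u1 u2 u3)"

lemma trilinear_weight_op: "trilinear \<Phi> \<Longrightarrow> trilinear (weight_op w \<Phi>)"
  by (rule trilinearI; simp add: lin_form_def weight_op_def trilinear_add trilinear_scale
      M1.L_add M1.L_scale M2.L_add M2.L_scale M3.L_add M3.L_scale algebra_simps)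

lemma trilinear_weight_op_pow: "trilinear \<Phi> \<Longrightarrow> trilinear ((weight_op w ^^ n) \<Phi>)"
  by (induction n) (auto intro: trilinear_weight_op)

lemma weight_op_nil:
  assumes "trilinear \<Phi>"
  shows "weight_op (l1 + l2 - l3) \<Phi> u1 u2 u3 =
    \<Phi> (M1.nil l1 u1) u2 u3 + \<Phi> u1 (M2.nil l2 u2) u3 - \<Phi> u1 u2 (M3.nil l3 u3)"
  by (simp add: weight_op_def trilinear_diff[OF assms] trilinear_scale[OF assms] algebra_simps)

text \<open>By \<open>weight_op_nil\<close> the operator is a signed sum of three operators, one
  acting in each argument. Each application lowers one of the exponents a, b, c by one, and an
  exponent 0 means that the corresponding vector is zero.\<close>

lemma weight_op_pow_homogeneous:
  assumes "trilinear \<Phi>" "(M1.nil l1 ^^ a) u1 = 0" "(M2.nil l2 ^^ b) u2 = 0"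
    "(M3.nil l3 ^^ c) u3 = 0" "a + b + c \<le> n"
  shows "(weight_op (l1 + l2 - l3) ^^ n) \<Phi> u1 u2 u3 = 0"
  using assms(2-)
proof (induction n arbitrary: u1 u2 u3 a b c)
  case 0
  then show ?case using assms(1) by (simp add: trilinear_zeros)
next
  case (Suc n)
  let ?\<Psi> = "(weight_op (l1 + l2 - l3) ^^ n) \<Phi>"
  note tri = trilinear_weight_op_pow[OF assms(1), of n "l1 + l2 - l3"]
  have step: "(weight_op (l1 + l2 - l3) ^^ Suc n) \<Phi> u1 u2 u3 = 
    ?\<Psi> (M1.nil l1 u1) u2 u3 + ?\<Psi> u1 (M2.nil l2 u2) u3 - ?\<Psi> u1 u2 (M3.nil l3 u3)"
    unfolding funpow.simps o_apply weight_op_nil[OF tri] ..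
  show ?case
  proof (cases "a = 0 \<or> b = 0 \<or> c = 0")
    case True
    then have "u1 = 0 \<or> u2 = 0 \<or> u3 = 0" using Suc.prems by auto
    then show ?thesis using trilinear_zeros[OF trilinear_weight_op_pow[OF assms(1)]] by blast
  next
    case False
    then obtain a' b' c' where abc: "a = Suc a'" "b = Suc b'" "c = Suc c'"
      by (metis not0_implies_Suc)
    have shifted0: "(M1.nil l1 ^^ a') (M1.nil l1 u1) = 0" "(M2.nil l2 ^^ b') (M2.nil l2 u2) = 0"
      "(M3.nil l3 ^^ c') (M3.nil l3 u3) = 0"
      using Suc.prems(1-3) unfolding abc funpow_Suc_right o_apply .
    have "?\<Psi> (M1.nil l1 u1) u2 u3 = 0"
      by (rule Suc.IH[of a' _ b _ c]) (use Suc.prems(2,3,4) shifted0(1) abc(1) in simp_all)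
    moreover have "?\<Psi> u1 (M2.nil l2 u2) u3 = 0"
      by (rule Suc.IH[of a _ b' _ c]) (use Suc.prems(1,3,4) shifted0(2) abc(2) in simp_all)
    moreover have "?\<Psi> u1 u2 (M3.nil l3 u3) = 0"
      by (rule Suc.IH[of a _ b _ c']) (use Suc.prems(1,2,4) shifted0(3) abc(3) in simp_all)
    ultimately show ?thesis unfolding step by simp
  qed
qed

definition concentrated :: "complex \<Rightarrow> ('m1 \<Rightarrow> 'm2 \<Rightarrow> 'm3 \<Rightarrow> complex) \<Rightarrow> bool" where
  "concentrated w \<Phi> \<longleftrightarrow> (\<forall>l1 l2 l3. \<forall>u1\<in>M1.ge l1. \<forall>u2\<in>M2.ge l2. \<forall>u3\<in>M3.ge l3.
     l1 + l2 - l3 \<noteq> w \<longrightarrow> \<Phi> u1 u2 u3 = 0)"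

lemma concentratedD:
  "concentrated w \<Phi> \<Longrightarrow> u1 \<in> M1.ge l1 \<Longrightarrow> u2 \<in> M2.ge l2 \<Longrightarrow> u3 \<in> M3.ge l3 \<Longrightarrow>
    l1 + l2 - l3 \<noteq> w \<Longrightarrow> \<Phi> u1 u2 u3 = 0"
  unfolding concentrated_def by blast

lemma concentrated_weight_op: "concentrated w \<Phi> \<Longrightarrow> concentrated w (weight_op w' \<Phi>)"
  unfolding concentrated_def weight_op_def using M1.L_ge M2.L_ge M3.L_ge by simp

text \<open>On the given eigenspaces the last assumption says that T \<Phi> = w \<Phi>, so T - (l1 +
  l2 - l3) acts on \<Phi> as the nonzero scalar w - (l1 + l2 - l3). It is also nilpotent there,
  hence \<Phi> vanishes. The assumption ranges over whole eigenspaces because T moves the vectors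
  inside them.\<close>

lemma eigenform_zero:
  assumes "trilinear \<Phi>" "w \<noteq> l1 + l2 - l3" "u1 \<in> M1.ge l1" "u2 \<in> M2.ge l2" "u3 \<in> M3.ge l3"
    and "\<And>u1 u2 u3. u1 \<in> M1.ge l1 \<Longrightarrow> u2 \<in> M2.ge l2 \<Longrightarrow> u3 \<in> M3.ge l3 \<Longrightarrow> weight_op w \<Phi> u1 u2 u3 = 0"
  shows "\<Phi> u1 u2 u3 = 0"
proof -
  let ?l = "l1 + l2 - l3"
  have weight_op: "weight_op ?l \<Psi> u1 u2 u3 = weight_op w \<Psi> u1 u2 u3 + (w - ?l) * \<Psi> u1 u2 u3" for \<Psi> u1 u2 u3
    by (simp add: weight_op_def algebra_simps)
  have pow: "(weight_op ?l ^^ n) \<Phi> u1 u2 u3 = (w - ?l) ^ n * \<Phi> u1 u2 u3"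
    if "u1 \<in> M1.ge l1" "u2 \<in> M2.ge l2" "u3 \<in> M3.ge l3" for n u1 u2 u3
    using that
  proof (induction n arbitrary: u1 u2 u3)
    case (Suc n)
    have "(weight_op ?l ^^ Suc n) \<Phi> u1 u2 u3 = (w - ?l) ^ n * weight_op ?l \<Phi> u1 u2 u3"
      unfolding funpow.simps o_apply weight_op_def[of ?l "(weight_op ?l ^^ n) \<Phi>"] weight_op_def[of ?l \<Phi>]
      by (simp add: Suc M1.L_ge M2.L_ge M3.L_ge right_diff_distrib distrib_left mult.left_commute)
    then show ?case unfolding weight_op[of \<Phi>] using assms(6)[OF Suc.prems] by simp
  qed simp
  have "(weight_op ?l ^^ (K1 + K2 + K3)) \<Phi> u1 u2 u3 = 0"
    by (rule weight_op_pow_homogeneous) (use assms in \<open>auto simp: gen_eigenspace_def\<close>)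
  then show ?thesis using pow[OF assms(3-5)] assms(2) by simp
qed

text \<open>Induction on the nilpotency order: \<open>weight_op w \<Phi>\<close> has smaller order,
  so it vanishes off weight w, and \<open>eigenform_zero\<close> passes this on to \<Phi>.\<close>

lemma weight_op_nilpotent_concentrated:
  assumes "trilinear \<Phi>" "(weight_op w ^^ n) \<Phi> = (\<lambda>u1 u2 u3. 0)"
  shows "concentrated w \<Phi>"
  using assms
proof (induction n arbitrary: \<Phi>)
  case (Suc n)
  have conc: "concentrated w (weight_op w \<Phi>)"
  proof (rule Suc.IH)
    show "trilinear (weight_op w \<Phi>)" by (rule trilinear_weight_op[OF Suc.prems(1)])
    show "(weight_op w ^^ n) (weight_op w \<Phi>) = (\<lambda>u1 u2 u3. 0)"
      using Suc.prems(2) unfolding funpow_Suc_right o_apply .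
  qed
  show ?case
    unfolding concentrated_def
  proof (intro allI ballI impI)
    fix l1 l2 l3 u1 u2 u3
    assume u: "u1 \<in> M1.ge l1" "u2 \<in> M2.ge l2" "u3 \<in> M3.ge l3" and ne: "l1 + l2 - l3 \<noteq> w"
    show "\<Phi> u1 u2 u3 = 0"
      by (rule eigenform_zero[OF Suc.prems(1) ne[symmetric] u]) (rule concentratedD[OF conc _ _ _ ne])
  qed
qed (simp add: concentrated_def)

section \<open>Components of a form and the coefficients of the powers of log z\<close>

definition comp :: "complex \<Rightarrow> ('m1 \<Rightarrow> 'm2 \<Rightarrow> 'm3 \<Rightarrow> complex) \<Rightarrow> 'm1 \<Rightarrow> 'm2 \<Rightarrow> 'm3 \<Rightarrow> complex" where
  "comp w \<Phi> u1 u2 u3 =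
    fsum (\<lambda>l1. fsum (\<lambda>l2. \<Phi> (M1.pr l1 u1) (M2.pr l2 u2) (M3.pr (l1 + l2 - w) u3)))"

context
  fixes \<Phi> assumes tri: "trilinear \<Phi>"
begin

lemma finite_comp2: "finite {l2. \<Phi> u1 (M2.pr l2 u2) (g l2) \<noteq> 0}"
  by (rule finite_subset[OF _ M2.finite_pr[of u2]]) (auto simp: trilinear_zeros[OF tri])

lemma finite_comp1: "finite {l1. fsum (\<lambda>l2. \<Phi> (M1.pr l1 u1) (f l1 l2) (g l1 l2)) \<noteq> 0}"
  by (rule finite_subset[OF _ M1.finite_pr[of u1]]) (auto simp: trilinear_zeros[OF tri])

lemma trilinear_comp: "trilinear (comp w \<Phi>)"
  by (rule trilinearI; simp add: lin_form_def comp_def M1.pr_add M2.pr_add M3.pr_add M1.pr_scale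
      M2.pr_scale M3.pr_scale trilinear_add[OF tri] trilinear_scale[OF tri] fsum_mult
      fsum_add finite_comp1 finite_comp2)

text \<open>The third weight l1 + l2 - w in \<open>comp\<close> is the only one compatible with
  total weight w. On a homogeneous triple the double sum therefore collapses to at most one
  term.\<close>

lemma comp_homogeneous:
  assumes "u1 \<in> M1.ge l1" "u2 \<in> M2.ge l2" "u3 \<in> M3.ge l3"
  shows "comp w \<Phi> u1 u2 u3 = (if l1 + l2 - l3 = w then \<Phi> u1 u2 u3 else 0)"
proof -
  have "comp w \<Phi> u1 u2 u3 = fsum (\<lambda>l. fsum (\<lambda>m. if l = l1 \<and> m = l2 \<and> l1 + l2 - l3 = w
    then \<Phi> u1 u2 u3 else 0))"
    unfolding comp_def using assms
    by (intro arg_cong[of _ _ fsum] ext) 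
      (auto simp: M1.pr_ge_eq M2.pr_ge_eq M3.pr_ge_eq trilinear_zeros[OF tri])
  also have "\<dots> = (\<Sum>l\<in>{l1}. \<Sum>m\<in>{l2}. if l = l1 \<and> m = l2 \<and> l1 + l2 - l3 = w then \<Phi> u1 u2 u3 else 0)"
    by (subst fsum_eq_sum[of "{l1}"], simp, simp, subst fsum_eq_sum[of "{l2}"]) auto
  finally show ?thesis by auto
qed

lemma concentrated_comp: "concentrated w (comp w \<Phi>)"
  unfolding concentrated_def using comp_homogeneous by auto

end

text \<open>A homogeneous triple has one total weight, and the component of that weight agrees on it
  with the whole form.\<close>

lemma comp_eqD:
  assumes "trilinear \<Phi>" "trilinear \<Psi>" "\<And>w. comp w \<Phi> = comp w \<Psi>"
  shows "\<Phi> = \<Psi>"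
proof (rule trilinear_eqI[OF assms(1,2)])
  fix l1 l2 l3 u1 u2 u3
  assume u: "u1 \<in> M1.ge l1" "u2 \<in> M2.ge l2" "u3 \<in> M3.ge l3"
  then show "\<Phi> u1 u2 u3 = \<Psi> u1 u2 u3"
    using comp_homogeneous[OF assms(1) u, of "l1 + l2 - l3"]
      comp_homogeneous[OF assms(2) u, of "l1 + l2 - l3"] assms(3) by simp
qed

text \<open>\<open>log_coeff n w \<Phi>\<close> is the coefficient of \<open>z^(-w) (log z)^n\<close> in
  \<open>\<Phi>(z^(-L0) u1, z^(-L0) u2, z^(L0) u3)\<close>.\<close>
fun log_coeff :: "nat \<Rightarrow> complex \<Rightarrow> ('m1 \<Rightarrow> 'm2 \<Rightarrow> 'm3 \<Rightarrow> complex) \<Rightarrow> 'm1 \<Rightarrow> 'm2 \<Rightarrow> 'm3 \<Rightarrow> complex" where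
  "log_coeff 0 w \<Phi> = comp w \<Phi>"
| "log_coeff (Suc n) w \<Phi> = (\<lambda>u1 u2 u3. - 1 / of_nat (Suc n) * weight_op w (log_coeff n w \<Phi>) u1 u2 u3)"

lemma trilinear_log_coeff: "trilinear \<Phi> \<Longrightarrow> trilinear (log_coeff n w \<Phi>)"
proof (induction n)
  case (Suc n)
  then show ?case
    using trilinear_lincomb[OF trilinear_weight_op trilinear_weight_op, of "log_coeff n w \<Phi>" "log_coeff n w \<Phi>" "- 1 / of_nat (Suc n)" w 0 w]
    by simp
qed (simp add: trilinear_comp)

lemma concentrated_log_coeff: "trilinear \<Phi> \<Longrightarrow> concentrated w (log_coeff n w \<Phi>)"
proof (induction n)
  case (Suc n)
  then have "concentrated w (weight_op w (log_coeff n w \<Phi>))" by (intro concentrated_weight_op) auto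
  then show ?case unfolding concentrated_def by simp
qed (simp add: concentrated_comp)

lemma weight_op_log_coeff: "weight_op w (log_coeff n w \<Phi>) u1 u2 u3 = - of_nat (n + 1) * log_coeff (Suc n) w \<Phi> u1 u2 u3"
  by (simp add: field_simps del: of_nat_Suc)

lemma weight_op_scale: "weight_op w (\<lambda>u1 u2 u3. c * \<Phi> u1 u2 u3) = (\<lambda>u1 u2 u3. c * weight_op w \<Phi> u1 u2 u3)"
  by (simp add: weight_op_def algebra_simps)

text \<open>These are the Taylor coefficients in log z of exp(-(T - w) log z) applied to the
  component of weight w.\<close>

lemma log_coeff_weight_op_pow: "log_coeff n w \<Phi> u1 u2 u3 = (-1) ^ n / fact n * (weight_op w ^^ n) (comp w \<Phi>) u1 u2 u3"
proof (induction n arbitrary: u1 u2 u3)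
  case (Suc n)
  have "log_coeff n w \<Phi> = (\<lambda>u1 u2 u3. (-1) ^ n / fact n * (weight_op w ^^ n) (comp w \<Phi>) u1 u2 u3)"
    using Suc by blast
  then have "log_coeff (Suc n) w \<Phi> u1 u2 u3 = - 1 / of_nat (Suc n) * ((-1) ^ n / fact n * weight_op w ((weight_op w ^^ n) (comp w \<Phi>)) u1 u2 u3)"
    by (simp only: log_coeff.simps weight_op_scale)
  then show ?case by (simp add: field_simps)
qed simp

text \<open>The nilpotency order depends neither on the vectors nor on w, which yields the uniform
  bound on the powers of log z required of an intertwining operator.\<close>

lemma log_coeff_eventually_zero:
  assumes "trilinear \<Phi>" "n \<ge> K1 + K2 + K3"
  shows "log_coeff n w \<Phi> = (\<lambda>u1 u2 u3. 0)"
proof (rule trilinear_eqI)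
  show "trilinear (log_coeff n w \<Phi>)" by (rule trilinear_log_coeff[OF assms(1)])
  show "trilinear (\<lambda>u1 u2 u3. 0)" by (simp add: trilinear_def lin_form_def)
  fix l1 l2 l3 u1 u2 u3
  assume u: "u1 \<in> M1.ge l1" "u2 \<in> M2.ge l2" "u3 \<in> M3.ge l3"
  show "log_coeff n w \<Phi> u1 u2 u3 = 0"
  proof (cases "w = l1 + l2 - l3")
    case True
    have "(weight_op (l1 + l2 - l3) ^^ n) (comp w \<Phi>) u1 u2 u3 = 0"
      by (rule weight_op_pow_homogeneous[OF trilinear_comp[OF assms(1)]])
        (use u assms(2) in \<open>auto simp: gen_eigenspace_def\<close>)
    then show ?thesis by (simp add: log_coeff_weight_op_pow True)
  next
    case False
    then show ?thesis using concentratedD[OF concentrated_log_coeff[OF assms(1)] u, of w n] by simp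
  qed
qed

lemma comp_lincomb:
  assumes "trilinear \<Phi>" "trilinear \<Psi>"
  shows "comp w (\<lambda>u1 u2 u3. a * \<Phi> u1 u2 u3 + b * \<Psi> u1 u2 u3) =
    (\<lambda>u1 u2 u3. a * comp w \<Phi> u1 u2 u3 + b * comp w \<Psi> u1 u2 u3)"
proof (rule trilinear_eqI)
  note tri = trilinear_lincomb[OF assms, of a b]
  show "trilinear (comp w (\<lambda>u1 u2 u3. a * \<Phi> u1 u2 u3 + b * \<Psi> u1 u2 u3))"
    "trilinear (\<lambda>u1 u2 u3. a * comp w \<Phi> u1 u2 u3 + b * comp w \<Psi> u1 u2 u3)"
    by (intro trilinear_comp tri trilinear_lincomb assms)+
  show "comp w (\<lambda>u1 u2 u3. a * \<Phi> u1 u2 u3 + b * \<Psi> u1 u2 u3) u1 u2 u3 =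
      a * comp w \<Phi> u1 u2 u3 + b * comp w \<Psi> u1 u2 u3"
    if "u1 \<in> M1.ge l1" "u2 \<in> M2.ge l2" "u3 \<in> M3.ge l3" for l1 l2 l3 u1 u2 u3
    by (simp add: comp_homogeneous[OF tri that] comp_homogeneous[OF assms(1) that]
        comp_homogeneous[OF assms(2) that])
qed

lemma log_coeff_lincomb:
  assumes "trilinear \<Phi>" "trilinear \<Psi>"
  shows "log_coeff n w (\<lambda>u1 u2 u3. a * \<Phi> u1 u2 u3 + b * \<Psi> u1 u2 u3) =
    (\<lambda>u1 u2 u3. a * log_coeff n w \<Phi> u1 u2 u3 + b * log_coeff n w \<Psi> u1 u2 u3)"
  by (induction n) (simp_all add: comp_lincomb assms weight_op_def algebra_simps add_divide_distrib diff_divide_distrib)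

lemma finite_weights: "finite {l1 + l2 | l1 l2. M1.pr l1 u1 \<noteq> 0 \<and> M2.pr l2 u2 \<noteq> 0}"
  by (rule finite_subset[of _ "(\<lambda>(a, b). a + b) ` ({l1. M1.pr l1 u1 \<noteq> 0} \<times> {l2. M2.pr l2 u2 \<noteq> 0})"])
    (use M1.finite_pr M2.finite_pr in auto)

text \<open>A nonzero value survives on some triple of components, and concentration then fixes
  their total weight. This confines the exponents of z that given vectors can see.\<close>

lemma concentrated_nonzero:
  assumes "trilinear \<Phi>" "concentrated w \<Phi>" "\<Phi> u1 u2 u3 \<noteq> 0"
  obtains l1 l2 l3 where "M1.pr l1 u1 \<noteq> 0" "M2.pr l2 u2 \<noteq> 0" "M3.pr l3 u3 \<noteq> 0" "w = l1 + l2 - l3"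
proof -
  obtain l1 where 1: "M1.pr l1 u1 \<noteq> 0" "\<Phi> (M1.pr l1 u1) u2 u3 \<noteq> 0"
    using M1.lin_form_nonzero[OF trilinear1[OF assms(1)] assms(3)] by blast
  obtain l2 where 2: "M2.pr l2 u2 \<noteq> 0" "\<Phi> (M1.pr l1 u1) (M2.pr l2 u2) u3 \<noteq> 0"
    using M2.lin_form_nonzero[OF trilinear2[OF assms(1)] 1(2)] by blast
  obtain l3 where 3: "M3.pr l3 u3 \<noteq> 0" "\<Phi> (M1.pr l1 u1) (M2.pr l2 u2) (M3.pr l3 u3) \<noteq> 0"
    using M3.lin_form_nonzero[OF trilinear3[OF assms(1)] 2(2)] by blast
  have "w = l1 + l2 - l3"
  proof (rule ccontr)
    assume "w \<noteq> l1 + l2 - l3"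
    then have "\<Phi> (M1.pr l1 u1) (M2.pr l2 u2) (M3.pr l3 u3) = 0"
      by (intro concentratedD[OF assms(2) M1.pr_ge M2.pr_ge M3.pr_ge]) auto
    then show False using 3(2) by contradiction
  qed
  then show ?thesis using that 1(1) 2(1) 3(1) by blast
qed

definition locally_finite :: "(nat \<Rightarrow> 'm1 \<Rightarrow> 'm2 \<Rightarrow> 'm3 \<Rightarrow> complex) \<Rightarrow> bool" where
  "locally_finite \<Psi> \<longleftrightarrow> (\<forall>u1 u2 u3. finite {i. \<Psi> i u1 u2 u3 \<noteq> 0})"

text \<open>The Borcherds-type identities are infinite sums of forms that become finite only after
  evaluation on vectors. The lemmas below let \<open>weight_op\<close>, \<open>comp\<close> and
  \<open>log_coeff\<close> pass through such sums.\<close>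

definition form_sum :: "(nat \<Rightarrow> 'm1 \<Rightarrow> 'm2 \<Rightarrow> 'm3 \<Rightarrow> complex) \<Rightarrow> 'm1 \<Rightarrow> 'm2 \<Rightarrow> 'm3 \<Rightarrow> complex" where
  "form_sum \<Psi> u1 u2 u3 = fsum (\<lambda>i. \<Psi> i u1 u2 u3)"

lemma finite_support_scale: "finite {i. f i \<noteq> 0} \<Longrightarrow> finite {i. c * f i \<noteq> (0::complex)}"
  by (erule rev_finite_subset) auto

lemma finite_support_diff:
  "finite {i. f i \<noteq> 0} \<Longrightarrow> finite {i. g i \<noteq> 0} \<Longrightarrow> finite {i. f i - g i \<noteq> (0::complex)}"
  by (rule finite_subset[of _ "{i. f i \<noteq> 0} \<union> {i. g i \<noteq> 0}"]) auto

lemma locally_finite_weight_op: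
  assumes "locally_finite \<Psi>" shows "locally_finite (\<lambda>i. weight_op w (\<Psi> i))"
proof -
  have fin: "finite {i. \<Psi> i v1 v2 v3 \<noteq> 0}" for v1 v2 v3
    using assms by (simp add: locally_finite_def)
  show ?thesis
    unfolding locally_finite_def weight_op_def
    by (intro allI finite_support_diff finite_support_add finite_support_scale fin)
qed

lemma weight_op_form_sum:
  assumes "locally_finite \<Psi>" shows "weight_op w (form_sum \<Psi>) = form_sum (\<lambda>i. weight_op w (\<Psi> i))"
proof (intro ext)
  fix u1 u2 u3
  have fin: "finite {i. \<Psi> i v1 v2 v3 \<noteq> 0}" for v1 v2 v3
    using assms by (simp add: locally_finite_def)
  show "weight_op w (form_sum \<Psi>) u1 u2 u3 = form_sum (\<lambda>i. weight_op w (\<Psi> i)) u1 u2 u3"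
    unfolding form_sum_def weight_op_def
    by (subst fsum_diff, (intro finite_support_diff finite_support_add finite_support_scale fin)+,
        subst fsum_diff, (intro finite_support_add fin)+, subst fsum_add)
      (simp_all add: fin fsum_mult)
qed

lemma trilinear_form_sum:
  assumes "locally_finite \<Psi>" "\<And>i. trilinear (\<Psi> i)"
  shows "trilinear (form_sum \<Psi>)"
  using assms(1) unfolding locally_finite_def
  by (intro trilinearI; simp add: lin_form_def form_sum_def trilinear_add[OF assms(2)]
      trilinear_scale[OF assms(2)] fsum_mult fsum_add)

text \<open>\<open>comp\<close> evaluates every member of the family on the same finite set of
  triples of components, so the support lies in a finite union of finite sets.\<close>

lemma locally_finite_comp:
  assumes "locally_finite \<Psi>" "\<And>i. trilinear (\<Psi> i)"
  shows "locally_finite (\<lambda>i. comp w (\<Psi> i))"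
  unfolding locally_finite_def
proof (intro allI)
  fix u1 u2 u3
  let ?A = "{l. M1.pr l u1 \<noteq> 0}" and ?B = "{l. M2.pr l u2 \<noteq> 0}"
  let ?v = "\<lambda>i l1 l2. \<Psi> i (M1.pr l1 u1) (M2.pr l2 u2) (M3.pr (l1 + l2 - w) u3)"
  have "i \<in> (\<Union>l1\<in>?A. \<Union>l2\<in>?B. {i. ?v i l1 l2 \<noteq> 0})" if "comp w (\<Psi> i) u1 u2 u3 \<noteq> 0" for i
  proof (rule ccontr)
    assume *: "\<not> ?thesis"
    have "?v i l1 l2 = 0" for l1 l2
    proof (cases "l1 \<in> ?A \<and> l2 \<in> ?B")
      case True
      then show ?thesis using * by blast
    next
      case False
      then show ?thesis by (auto simp: trilinear_zeros[OF assms(2)])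
    qed
    then show False using that by (simp add: comp_def)
  qed
  then have sub: "{i. comp w (\<Psi> i) u1 u2 u3 \<noteq> 0} \<subseteq> (\<Union>l1\<in>?A. \<Union>l2\<in>?B. {i. ?v i l1 l2 \<noteq> 0})"
    by blast
  show "finite {i. comp w (\<Psi> i) u1 u2 u3 \<noteq> 0}"
    by (rule finite_subset[OF sub]) (use assms(1) M1.finite_pr M2.finite_pr in
        \<open>auto simp: locally_finite_def intro!: finite_UN_I\<close>)
qed

lemma comp_form_sum:
  assumes "locally_finite \<Psi>" "\<And>i. trilinear (\<Psi> i)"
  shows "comp w (form_sum \<Psi>) = form_sum (\<lambda>i. comp w (\<Psi> i))"
proof (rule trilinear_eqI)
  note tri = trilinear_form_sum[OF assms]
  show "trilinear (comp w (form_sum \<Psi>))" by (rule trilinear_comp[OF tri])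
  show "trilinear (form_sum (\<lambda>i. comp w (\<Psi> i)))"
    by (intro trilinear_form_sum locally_finite_comp trilinear_comp assms)
  fix l1 l2 l3 u1 u2 u3
  assume u: "u1 \<in> M1.ge l1" "u2 \<in> M2.ge l2" "u3 \<in> M3.ge l3"
  show "comp w (form_sum \<Psi>) u1 u2 u3 = form_sum (\<lambda>i. comp w (\<Psi> i)) u1 u2 u3"
    by (simp add: comp_homogeneous[OF tri u] form_sum_def comp_homogeneous[OF assms(2) u])
qed

lemma log_coeff_form_sum:
  assumes "locally_finite \<Psi>" "\<And>i. trilinear (\<Psi> i)"
  shows "locally_finite (\<lambda>i. log_coeff n w (\<Psi> i)) \<and> log_coeff n w (form_sum \<Psi>) = form_sum (\<lambda>i. log_coeff n w (\<Psi> i))"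
proof (induction n)
  case 0
  then show ?case by (simp add: comp_form_sum locally_finite_comp assms)
next
  case (Suc n)
  then have "locally_finite (\<lambda>i. weight_op w (log_coeff n w (\<Psi> i)))" by (simp add: locally_finite_weight_op)
  then have lf: "locally_finite (\<lambda>i. log_coeff (Suc n) w (\<Psi> i))"
    by (simp add: locally_finite_def finite_support_scale del: of_nat_Suc)
  have "log_coeff (Suc n) w (form_sum \<Psi>) = (\<lambda>u1 u2 u3. - 1 / of_nat (Suc n) * form_sum (\<lambda>i. weight_op w (log_coeff n w (\<Psi> i))) u1 u2 u3)"
    using Suc by (simp add: weight_op_form_sum)
  also have "\<dots> = form_sum (\<lambda>i. log_coeff (Suc n) w (\<Psi> i))"
    by (intro ext) (simp only: form_sum_def log_coeff.simps fsum_mult)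
  finally show ?case using lf by blast
qed

section \<open>Pulling a form back along an operator of fixed weight\<close>

definition pull1 :: "('m1 \<Rightarrow> 'm1) \<Rightarrow> ('m1 \<Rightarrow> 'm2 \<Rightarrow> 'm3 \<Rightarrow> complex) \<Rightarrow> 'm1 \<Rightarrow> 'm2 \<Rightarrow> 'm3 \<Rightarrow> complex" where
  "pull1 B \<Phi> = (\<lambda>u1 u2 u3. \<Phi> (B u1) u2 u3)"
definition pull2 :: "('m2 \<Rightarrow> 'm2) \<Rightarrow> ('m1 \<Rightarrow> 'm2 \<Rightarrow> 'm3 \<Rightarrow> complex) \<Rightarrow> 'm1 \<Rightarrow> 'm2 \<Rightarrow> 'm3 \<Rightarrow> complex" where
  "pull2 B \<Phi> = (\<lambda>u1 u2 u3. \<Phi> u1 (B u2) u3)"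
definition pull3 :: "('m3 \<Rightarrow> 'm3) \<Rightarrow> ('m1 \<Rightarrow> 'm2 \<Rightarrow> 'm3 \<Rightarrow> complex) \<Rightarrow> 'm1 \<Rightarrow> 'm2 \<Rightarrow> 'm3 \<Rightarrow> complex" where
  "pull3 B \<Phi> = (\<lambda>u1 u2 u3. \<Phi> u1 u2 (B u3))"

lemmas pull_defs = pull1_def pull2_def pull3_def

lemma trilinear_pull:
  assumes "trilinear \<Phi>"
  shows "M1.shifts B1 c \<Longrightarrow> trilinear (pull1 B1 \<Phi>)"
    "M2.shifts B2 c \<Longrightarrow> trilinear (pull2 B2 \<Phi>)"
    "M3.shifts B3 c \<Longrightarrow> trilinear (pull3 B3 \<Phi>)"
  unfolding M1.shifts_def M2.shifts_def M3.shifts_def Vector_Spaces.linear_iff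
  by (rule trilinearI; simp add: lin_form_def pull_defs trilinear_add[OF assms] trilinear_scale[OF assms])+

text \<open>\<open>B\<close> raises the weight of the first argument by c, so the part of weight w
  of the pullback comes from weight w + c. The commutator relation gives the same shift in
  \<open>weight_op\<close>, which settles the higher powers of log z.\<close>

lemma log_coeff_pull1:
  assumes "trilinear \<Phi>" "M1.shifts B c"
  shows "log_coeff n w (pull1 B \<Phi>) = pull1 B (log_coeff n (w + c) \<Phi>)"
proof (induction n)
  case 0
  have "comp w (pull1 B \<Phi>) = pull1 B (comp (w + c) \<Phi>)"
  proof (rule trilinear_eqI)
    fix l1 l2 l3 u1 u2 u3
    assume u: "u1 \<in> M1.ge l1" "u2 \<in> M2.ge l2" "u3 \<in> M3.ge l3"
    have "l1 + c + l2 - l3 = w + c \<longleftrightarrow> l1 + l2 - l3 = w" by (auto simp: algebra_simps)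
    then show "comp w (pull1 B \<Phi>) u1 u2 u3 = pull1 B (comp (w + c) \<Phi>) u1 u2 u3"
      using comp_homogeneous[OF assms(1) M1.shifts_ge[OF assms(2) u(1)] u(2,3), of "w + c"]
      by (simp add: comp_homogeneous[OF trilinear_pull(1)[OF assms] u]) (simp add: pull_defs)
  qed (intro trilinear_comp trilinear_pull(1)[OF _ assms(2)] assms(1))+
  then show ?case by simp
next
  case (Suc n)
  have "weight_op w (pull1 B \<Psi>) = pull1 B (weight_op (w + c) \<Psi>)" if "trilinear \<Psi>" for \<Psi>
    using assms(2) by (intro ext) (simp add: M1.shifts_def weight_op_def pull_defs trilinear_add[OF that]
        trilinear_scale[OF that] algebra_simps)
  then show ?case by (simp add: Suc trilinear_log_coeff assms(1)) (simp add: pull_defs)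
qed

lemma log_coeff_pull2:
  assumes "trilinear \<Phi>" "M2.shifts B c"
  shows "log_coeff n w (pull2 B \<Phi>) = pull2 B (log_coeff n (w + c) \<Phi>)"
proof (induction n)
  case 0
  have "comp w (pull2 B \<Phi>) = pull2 B (comp (w + c) \<Phi>)"
  proof (rule trilinear_eqI)
    fix l1 l2 l3 u1 u2 u3
    assume u: "u1 \<in> M1.ge l1" "u2 \<in> M2.ge l2" "u3 \<in> M3.ge l3"
    have "l1 + (l2 + c) - l3 = w + c \<longleftrightarrow> l1 + l2 - l3 = w" by (auto simp: algebra_simps)
    then show "comp w (pull2 B \<Phi>) u1 u2 u3 = pull2 B (comp (w + c) \<Phi>) u1 u2 u3"
      using comp_homogeneous[OF assms(1) u(1) M2.shifts_ge[OF assms(2) u(2)] u(3), of "w + c"]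
      by (simp add: comp_homogeneous[OF trilinear_pull(2)[OF assms] u]) (simp add: pull_defs)
  qed (intro trilinear_comp trilinear_pull(2)[OF _ assms(2)] assms(1))+
  then show ?case by simp
next
  case (Suc n)
  have "weight_op w (pull2 B \<Psi>) = pull2 B (weight_op (w + c) \<Psi>)" if "trilinear \<Psi>" for \<Psi>
    using assms(2) by (intro ext) (simp add: M2.shifts_def weight_op_def pull_defs trilinear_add[OF that]
        trilinear_scale[OF that] algebra_simps)
  then show ?case by (simp add: Suc trilinear_log_coeff assms(1)) (simp add: pull_defs)
qed

text \<open>The third argument enters the total weight with a minus sign, hence w - c here.\<close>

lemma log_coeff_pull3:
  assumes "trilinear \<Phi>" "M3.shifts B c"
  shows "log_coeff n w (pull3 B \<Phi>) = pull3 B (log_coeff n (w - c) \<Phi>)"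
proof (induction n)
  case 0
  have "comp w (pull3 B \<Phi>) = pull3 B (comp (w - c) \<Phi>)"
  proof (rule trilinear_eqI)
    fix l1 l2 l3 u1 u2 u3
    assume u: "u1 \<in> M1.ge l1" "u2 \<in> M2.ge l2" "u3 \<in> M3.ge l3"
    have "l1 + l2 - (l3 + c) = w - c \<longleftrightarrow> l1 + l2 - l3 = w" by (auto simp: algebra_simps)
    then show "comp w (pull3 B \<Phi>) u1 u2 u3 = pull3 B (comp (w - c) \<Phi>) u1 u2 u3"
      using comp_homogeneous[OF assms(1) u(1,2) M3.shifts_ge[OF assms(2) u(3)], of "w - c"]
      by (simp add: comp_homogeneous[OF trilinear_pull(3)[OF assms] u]) (simp add: pull_defs)
  qed (intro trilinear_comp trilinear_pull(3)[OF _ assms(2)] assms(1))+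
  then show ?case by simp
next
  case (Suc n)
  have "weight_op w (pull3 B \<Psi>) = pull3 B (weight_op (w - c) \<Psi>)" if "trilinear \<Psi>" for \<Psi>
    using assms(2) by (intro ext) (simp add: M3.shifts_def weight_op_def pull_defs trilinear_add[OF that]
        trilinear_scale[OF that] algebra_simps)
  then show ?case by (simp add: Suc trilinear_log_coeff assms(1)) (simp add: pull_defs)
qed

end

section \<open>Expansions of rational functions\<close>

lemma ibin_Suc: "ibin (q + 1) (Suc i) = ibin q i + ibin q (Suc i)"
  using gbinomial_Suc_Suc[of "of_int q :: complex" i] by (simp add: ibin_def)

lemma ibin_0 [simp]: "ibin q 0 = 1"
  by (simp add: ibin_def)

text \<open>The binomial series of (1 - x)^q for an integer q of either sign.\<close>

definition minus_binomial :: "int \<Rightarrow> complex fps" where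
  "minus_binomial q = Abs_fps (\<lambda>i. (-1) ^ i * ibin q i)"

lemma minus_binomial_step: "minus_binomial (q + 1) = (1 - fps_X) * minus_binomial q"
proof (rule fps_ext)
  fix n show "minus_binomial (q + 1) $ n = ((1 - fps_X) * minus_binomial q) $ n"
    by (cases n) (simp_all add: minus_binomial_def left_diff_distrib ibin_Suc distrib_left)
qed

lemma one_minus_fls_X_neq_0: "(1 - fls_X :: complex fls) \<noteq> 0"
proof
  assume "(1 - fls_X :: complex fls) = 0"
  then have "fls_nth (1 - fls_X :: complex fls) 0 = 0" by simp
  then show False by simp
qed

text \<open>By Pascal's rule both sides satisfy the same recursion in q. Below q = 0 it is solved by
  cancelling the nonzero series 1 - x.\<close>

lemma one_minus_fls_X_powi: "(1 - fls_X) powi q = fps_to_fls (minus_binomial q)"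
proof (induction q rule: int_induct[where k = 0])
  case base
  have "minus_binomial 0 = 1"
    by (rule fps_ext) (auto simp: minus_binomial_def ibin_def gbinomial_0_left)
  then show ?case by simp
next
  case (step1 i)
  then show ?case
    by (simp add: power_int_add_1' one_minus_fls_X_neq_0 minus_binomial_step fls_times_fps_to_fls)
next
  case (step2 i)
  have "(1 - fls_X) * fps_to_fls (minus_binomial (i - 1)) = (1 - fls_X) powi i"
    using minus_binomial_step[of "i - 1"] step2 by (simp add: fls_times_fps_to_fls)
  also have "\<dots> = (1 - fls_X) * (1 - fls_X) powi (i - 1)"
    using power_int_add_1'[of "1 - fls_X :: complex fls" "i - 1"] one_minus_fls_X_neq_0 by simp
  finally show ?case using one_minus_fls_X_neq_0 by simp
qed

section \<open>Expansions of z^p (z - 1)^q at 0, 1 and infinity\<close>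

definition binomial_fls :: "complex fls \<Rightarrow> int \<Rightarrow> int \<Rightarrow> complex fls" where
  "binomial_fls Z p q = Z powi p * (Z - 1) powi q"

lemma minus_one_powi: "(-1 :: complex fls) powi q = fls_const (isign q)"
proof -
  have "fls_const (-1 :: complex) = -1" by (rule fls_eqI) simp
  then show ?thesis by (auto simp: isign_def power_int_minus_left)
qed

text \<open>Here (z - 1)^q = (-1)^q (1 - z)^q, the origin of the sign \<open>isign q\<close> in the
  Borcherds identity.\<close>

lemma nth_binomial_fls_0:
  "fls_nth (binomial_fls fls_X p q) m =
    (if m < p then 0 else isign q * ((-1) ^ nat (m - p) * ibin q (nat (m - p))))"
proof -
  have "(fls_X - 1 :: complex fls) = (-1) * (1 - fls_X)" by simp
  then have "(fls_X - 1 :: complex fls) powi q = fls_const (isign q) * (1 - fls_X) powi q"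
    by (simp only: power_int_mult_distrib minus_one_powi)
  then have "binomial_fls fls_X p q = fls_const (isign q) * (fls_X_intpow p * fps_to_fls (minus_binomial q))"
    by (simp add: binomial_fls_def one_minus_fls_X_powi ac_simps)
  then show ?thesis by (simp add: fls_X_intpow_times_conv_shift minus_binomial_def)
qed

text \<open>With z = x + 1 the factor (z - 1)^q is the monomial x^q, and z^p becomes the binomial
  series of (1 + x)^p.\<close>

lemma nth_binomial_fls_1:
  "fls_nth (binomial_fls (fls_X + 1) p q) m = (if m < q then 0 else ibin p (nat (m - q)))"
proof -
  have "binomial_fls (fls_X + 1) p q = fls_X_intpow q * fps_to_fls (fps_binomial (of_int p))"
    by (simp add: binomial_fls_def one_plus_fls_X_powi_eq[symmetric] add.commute mult.commute)
  then show ?thesis by (simp add: fls_X_intpow_times_conv_shift ibin_def)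
qed

text \<open>With w = 1/z the function is w^(-p-q) (1 - w)^q, so no global sign appears and the
  exponents of z run downwards from p + q.\<close>

lemma nth_binomial_fls_infinity:
  "fls_nth (binomial_fls (inverse fls_X) p q) (- m) =
    (if p + q < m then 0 else (-1) ^ nat (p + q - m) * ibin q (nat (p + q - m)))"
proof -
  have "(inverse fls_X - 1 :: complex fls) = inverse fls_X * (1 - fls_X)"
    by (simp add: right_diff_distrib)
  then have "(inverse fls_X - 1 :: complex fls) powi q = inverse fls_X powi q * (1 - fls_X) powi q"
    by (simp only: power_int_mult_distrib)
  then have "binomial_fls (inverse fls_X) p q =
      (inverse fls_X powi p * inverse fls_X powi q) * fps_to_fls (minus_binomial q)"
    by (simp add: binomial_fls_def one_minus_fls_X_powi ac_simps)
  also have "inverse fls_X powi p * inverse fls_X powi q = (fls_X powi (-(p + q)) :: complex fls)"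
    by (simp add: power_int_inverse power_int_minus[symmetric] power_int_add[symmetric] del: fls_X_power_int)
  finally have "binomial_fls (inverse fls_X) p q = fls_X_intpow (-(p + q)) * fps_to_fls (minus_binomial q)"
    by simp
  also have "\<dots> = fls_shift (p + q) (fps_to_fls (minus_binomial q))"
    by (subst fls_X_intpow_times_conv_shift(1)) (simp add: add.commute)
  finally show ?thesis by (simp add: minus_binomial_def)
qed

section \<open>Passing between binomials and arbitrary numerators\<close>

lemma poly_fls_const:
  "poly (map_poly fls_const p) Z = (\<Sum>j\<le>degree p. fls_const (coeff p j) * (Z :: complex fls) ^ j)"
  by (subst poly_altdef) (simp add: degree_map_poly coeff_map_poly)

lemma poly_fls_const_add:
  "poly (map_poly fls_const (p + q)) (Z :: complex fls) = poly (map_poly fls_const p) Z + poly (map_poly fls_const q) Z"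
proof -
  have "map_poly fls_const (p + q) = map_poly fls_const p + map_poly (fls_const :: complex \<Rightarrow> _) q"
    by (rule poly_eqI) (simp add: coeff_map_poly fls_plus_const)
  then show ?thesis by simp
qed

lemma poly_fls_const_mult:
  "poly (map_poly fls_const (p * q)) (Z :: complex fls) = poly (map_poly fls_const p) Z * poly (map_poly fls_const q) Z"
proof (induction p)
  case (pCons a p)
  have "map_poly fls_const (smult a q) = smult (fls_const a) (map_poly fls_const q)"
    by (rule map_poly_smult) simp_all
  then show ?case
    by (simp add: poly_fls_const_add map_poly_pCons pCons.IH algebra_simps)
qed simp

lemma poly_fls_const_power:
  "poly (map_poly fls_const (p ^ n)) (Z :: complex fls) = poly (map_poly fls_const p) Z ^ n"
  by (induction n) (simp_all add: poly_fls_const_mult)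

text \<open>Positive parts of p and q go into the numerator, negative parts into the pole orders.
  Hence every z^p (z - 1)^q is one of the functions that test a conformal block.\<close>

lemma fexp_binomial:
  assumes "Z \<noteq> 0" "Z \<noteq> 1"
  shows "fexp Z ([:0, 1:] ^ nat p * [:-1, 1:] ^ nat q) (nat (- p)) (nat (- q)) = binomial_fls Z p q"
proof -
  have *: "W ^ nat r * inverse W ^ nat (- r) = W powi r" if "W \<noteq> 0" for W :: "complex fls" and r
    using that by (cases "r \<ge> 0") (auto simp: power_int_def)
  have 1: "poly (map_poly fls_const [:0, 1:]) Z = Z" "poly (map_poly fls_const [:-1, 1:]) Z = Z - 1"
    by (simp_all add: map_poly_pCons fls_const_uminus[symmetric])
  show ?thesis
    using *[OF assms(1), of p] *[of "Z - 1" q] assms(2)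
    by (simp add: fexp_def binomial_fls_def poly_fls_const_mult poly_fls_const_power 1)
      (metis (no_types, lifting) mult.assoc mult.commute)
qed

text \<open>Conversely, expanding the numerator in powers of z leaves a combination of the binomials
  with p = j - \<alpha> and q = -\<beta>.\<close>

lemma fexp_expand:
  assumes "Z \<noteq> 0" "Z \<noteq> 1"
  shows "fls_nth (fexp Z p \<alpha> \<beta>) m =
    (\<Sum>j\<le>degree p. coeff p j * fls_nth (binomial_fls Z (int j - int \<alpha>) (- int \<beta>)) m)"
proof -
  have "Z ^ j * inverse Z ^ \<alpha> = Z powi (int j - int \<alpha>)" for j
    using assms(1) by (simp add: power_int_diff power_int_of_nat field_simps power_inverse)
  moreover have "inverse (Z - 1) ^ \<beta> = (Z - 1) powi (- int \<beta>)"
    by (simp add: power_int_minus power_inverse)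
  ultimately have "fexp Z p \<alpha> \<beta> = (\<Sum>j\<le>degree p. fls_const (coeff p j) * binomial_fls Z (int j - int \<alpha>) (- int \<beta>))"
    by (simp add: fexp_def poly_fls_const sum_distrib_right binomial_fls_def mult.assoc)
  then show ?thesis by (simp add: fls_nth_sum)
qed

lemma expansion_points:
  "(fls_X :: complex fls) \<noteq> 0" "(fls_X :: complex fls) \<noteq> 1" "(fls_X + 1 :: complex fls) \<noteq> 0"
  "(fls_X + 1 :: complex fls) \<noteq> 1" "inverse (fls_X :: complex fls) \<noteq> 0" "inverse (fls_X :: complex fls) \<noteq> 1"
proof -
  show X1: "(fls_X :: complex fls) \<noteq> 1"
    using one_minus_fls_X_neq_0 by auto
  show "(fls_X + 1 :: complex fls) \<noteq> 0"
  proof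
    assume "(fls_X + 1 :: complex fls) = 0"
    then have "fls_nth (fls_X + 1 :: complex fls) 0 = 0" by simp
    then show False by simp
  qed
  show "inverse (fls_X :: complex fls) \<noteq> 1" using X1 by (metis inverse_1 inverse_inverse_eq)
qed simp_all

section \<open>Vertex operator algebras and modules\<close>

lemma ibin_zero_left: "ibin 0 i = (if i = 0 then 1 else 0)"
  by (simp add: ibin_def gbinomial_0_left)

lemma ibin_one_left: "ibin 1 i = (if i \<le> 1 then 1 else 0)"
proof (cases i)
  case (Suc j)
  then show ?thesis using ibin_Suc[of 0 j] by (auto simp: ibin_zero_left)
qed simp

lemma ibin_minus_two: "ibin (-2) i = (-1) ^ i * of_nat (i + 1)"
proof (induction i)
  case (Suc i)
  have m1: "ibin (-1) i = (-1) ^ i" for i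
  proof (induction i)
    case (Suc i)
    then show ?case using ibin_Suc[of "-1" i] by (simp add: ibin_zero_left add_eq_0_iff)
  qed simp
  have "ibin (-2) (Suc i) = ibin (-1) (Suc i) - ibin (-2) i"
    using ibin_Suc[of "-2" i] by simp
  then show ?case unfolding Suc m1 by (simp add: algebra_simps)
qed simp

lemma Vdeg_iff: "vector_space sV \<Longrightarrow> a \<in> Vdeg sV Y om k \<longleftrightarrow> a \<in> gen_eigenspace sV (Y om 1) (Suc 0) (of_nat k)"
  by (simp add: Vdeg_def gen_eigenspace_def)

section \<open>The grading of the vertex operator algebra\<close>

locale voa =
  fixes sV :: "complex \<Rightarrow> 'v::ab_group_add \<Rightarrow> 'v" and Y :: "'v \<Rightarrow> int \<Rightarrow> 'v \<Rightarrow> 'v" and vac om :: 'v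
  assumes is_VOA: "is_VOA sV Y vac om"
begin

abbreviation "VD \<equiv> Vdeg sV Y om"

lemma vector_space_V: "vector_space sV" and linear_Y: "Vector_Spaces.linear sV sV (Y a n)"
  using is_VOA unfolding is_VOA_def by blast+

sublocale V: graded_space sV "Y om 1" 0 "Suc 0"
proof (intro graded_space.intro[OF vector_space_V] graded_space_axioms.intro)
  show "Vector_Spaces.linear sV sV (Y om 1)" by (rule linear_Y)
  have dec: "\<forall>a. \<exists>f. finite {k. f k \<noteq> 0} \<and> (\<forall>k. f k \<in> VD k) \<and> a = sum f {k. f k \<noteq> 0}"
    using is_VOA unfolding is_VOA_def by blast
  show "\<exists>f. finite {n. f n \<noteq> 0} \<and> (\<forall>n. f n \<in> gen_eigenspace sV (Y om 1) (Suc 0) (0 + of_nat n)) \<and>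
      u = sum f {n. f n \<noteq> 0}" for u
    using spec[OF dec, of u] by (simp add: Vdeg_iff[OF vector_space_V])
qed

lemma VD_iff: "a \<in> VD k \<longleftrightarrow> a \<in> V.ge (of_nat k)"
  by (rule Vdeg_iff[OF vector_space_V])

lemma vacuum_right: "n \<ge> 0 \<Longrightarrow> Y a n vac = 0" "Y a (-1) vac = a"
  and om_VD: "om \<in> VD 2"
  using is_VOA unfolding is_VOA_def by blast+

text \<open>The translation axiom for (L_(-1) a)_(n) at n = -1, evaluated on the vacuum.\<close>

lemma translation_V: "Y om 0 a = Y a (-2) vac"
proof -
  have "Y (Y om 0 a) (-1) = (\<lambda>b. sV (- of_int (-1)) (Y a (-1 - 1) b))"
    using is_VOA unfolding is_VOA_def by blast
  then have "Y (Y om 0 a) (-1) vac = Y a (-2) vac" by simp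
  then show ?thesis by (simp only: vacuum_right)
qed

lemma virasoro:
  assumes "m + n \<noteq> 0"
  shows "Y om (m + 1) (Y om (n + 1) v) - Y om (n + 1) (Y om (m + 1) v) = sV (of_int (m - n)) (Y om (m + n + 1) v)"
proof -
  obtain c where c: "\<forall>m n v. Y om (m + 1) (Y om (n + 1) v) - Y om (n + 1) (Y om (m + 1) v)
       = sV (of_int (m - n)) (Y om (m + n + 1) v)
         + (if m + n = 0 then sV ((of_int m ^ 3 - of_int m) / 12 * c) v else 0)"
    using is_VOA unfolding is_VOA_def by (elim conjE exE) (rule that)
  show ?thesis using c[rule_format, of m n v] assms by simp
qed

text \<open>Apply [L_1, L_(-2)] = 3 L_(-1) to the vacuum, which L_1 and L_(-1) annihilate. As a
  consequence \<open>theta_om\<close> has a single nonzero term.\<close>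

lemma L1_om: "Y om 2 om = 0"
proof -
  have z: "Y om n 0 = 0" for n
    using linear_Y[of om n] V.scale_zero_left unfolding Vector_Spaces.linear_iff by metis
  show ?thesis using virasoro[of 1 "-2" vac] by (simp add: vacuum_right z)
qed

lemma L1_zero: "Y om 2 0 = 0"
  using linear_Y[of om 2] V.scale_zero_left unfolding Vector_Spaces.linear_iff by metis

lemma L1_pow_ge:
  assumes "a \<in> VD k" shows "(Y om 2 ^^ j) a \<in> V.ge (of_nat k - of_nat j)"
proof (induction j)
  case 0
  then show ?case using assms by (simp add: VD_iff)
next
  case (Suc j)
  \<comment> \<open>This is the Virasoro relation [L_0, L_1] = - L_1.\<close>
  have "V.shifts (Y om 2) (-1)"
    using virasoro[of 0 1] linear_Y[of om 2] unfolding V.shifts_def by (auto simp: algebra_simps)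
  from V.shifts_ge[OF this Suc] show ?case by (simp add: algebra_simps)
qed

text \<open>The vector would have the negative degree k - j, while the grading starts at 0. This
  cuts off the sum over j in \<open>theta_act\<close>.\<close>

lemma L1_pow_zero:
  assumes "a \<in> VD k" "k < j" shows "(Y om 2 ^^ j) a = 0"
proof (rule ccontr)
  assume "(Y om 2 ^^ j) a \<noteq> 0"
  then obtain n where "(of_nat k - of_nat j :: complex) = 0 + of_nat n"
    using V.ge_weight[OF L1_pow_ge[OF assms(1)]] by blast
  then have "(of_nat k :: complex) = of_nat (j + n)" by (simp add: algebra_simps)
  then have "k = j + n" by (simp only: of_nat_eq_iff)
  then show False using assms(2) by simp
qed

lemma vcomp:
  shows finite_vcomp: "finite {k. vcomp sV Y om a k \<noteq> 0}" and vcomp_VD: "vcomp sV Y om a k \<in> VD k"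
    and sum_vcomp: "a = sum (vcomp sV Y om a) {k. vcomp sV Y om a k \<noteq> 0}"
proof -
  have "\<exists>f. finite {k. f k \<noteq> 0} \<and> (\<forall>k. f k \<in> VD k) \<and> a = sum f {k. f k \<noteq> 0}"
    using is_VOA unfolding is_VOA_def by blast
  then have "finite {k. vcomp sV Y om a k \<noteq> 0} \<and> (\<forall>k. vcomp sV Y om a k \<in> VD k) \<and>
      a = sum (vcomp sV Y om a) {k. vcomp sV Y om a k \<noteq> 0}"
    unfolding vcomp_def by (rule someI_ex)
  then show "finite {k. vcomp sV Y om a k \<noteq> 0}" "vcomp sV Y om a k \<in> VD k"
    "a = sum (vcomp sV Y om a) {k. vcomp sV Y om a k \<noteq> 0}" by blast+
qed

lemma zero_VD [simp]: "0 \<in> VD k"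
  by (simp add: VD_iff)

text \<open>\<open>vcomp\<close> is a choice of decomposition, but applying the projections
  \<open>V.pr\<close> shows that the choice is forced.\<close>

lemma vcomp_homogeneous:
  assumes "a \<in> VD k" shows "vcomp sV Y om a j = (if j = k then a else 0)"
proof -
  let ?c = "vcomp sV Y om a"
  have pr: "V.pr l a = V.pr l (fsum ?c)" for l
    using sum_vcomp[of a] by (simp add: fsum_def)
  have "V.pr l (fsum ?c) = fsum (\<lambda>i. V.pr l (?c i))" for l
    by (rule fsum_additive[OF V.pr_add _ finite_vcomp]) (simp add: V.pr_ge_eq[of 0 0])
  moreover have "V.pr (of_nat j) (?c i) = (if i = j then ?c j else 0)" for i
    using V.pr_ge_eq[of "?c i" "of_nat i" "of_nat j"] vcomp_VD[of a i] by (auto simp: VD_iff)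
  ultimately have "V.pr (of_nat j) a = ?c j"
    using pr[of "of_nat j"] by simp
  then show ?thesis using assms V.pr_ge_eq[of a "of_nat k" "of_nat j"] by (simp add: VD_iff)
qed

end

section \<open>Modules, their modes and the transposed action\<close>

locale voa_module = voa +
  fixes sM :: "complex \<Rightarrow> 'm::ab_group_add \<Rightarrow> 'm" and Ym :: "'a \<Rightarrow> int \<Rightarrow> 'm \<Rightarrow> 'm"
    and h :: complex and K :: nat
  assumes is_Ck: "is_Ck_module sV Y vac om sM Ym h K"
begin

lemma weak: "is_weak_module sV Y vac sM Ym"
  using is_Ck unfolding is_Ck_module_def by blast

lemma vector_space_M: "vector_space sM" and linear_Ym: "Vector_Spaces.linear sM sM (Ym a n)"
  and linear_Ym_left: "Vector_Spaces.linear sV sM (\<lambda>a. Ym a n u)"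
  and vacuum: "Ym vac n u = (if n = -1 then u else 0)"
  and truncation: "\<exists>N. \<forall>n\<ge>N. Ym a n u = 0"
  using weak unfolding is_weak_module_def by blast+

lemma borcherds_M:
  "fsum (\<lambda>i::nat. sM (ibin p i) (Ym (Y a (r + int i) b) (p + q - int i) c))
    = fsum (\<lambda>i::nat. sM ((-1)^i * ibin r i)
            (Ym a (p + r - int i) (Ym b (q + int i) c)
             - sM (isign r) (Ym b (q + r - int i) (Ym a (p + int i) c))))"
  using weak unfolding is_weak_module_def borcherds_def by blast

lemma gen_eig_eq: "gen_eig sM Ym om h K n = gen_eigenspace sM (Ym om 1) (Suc K) (h + of_nat n)"
  by (simp add: gen_eig_def gen_eigenspace_def)

lemma graded_space_M: "graded_space sM (Ym om 1) h (Suc K)"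
proof (intro graded_space.intro[OF vector_space_M] graded_space_axioms.intro)
  show "Vector_Spaces.linear sM sM (Ym om 1)" by (rule linear_Ym)
  show "\<exists>f. finite {n. f n \<noteq> 0} \<and> (\<forall>n. f n \<in> gen_eigenspace sM (Ym om 1) (Suc K) (h + of_nat n)) \<and>
      u = sum f {n. f n \<noteq> 0}" for u
    using is_Ck unfolding is_Ck_module_def gen_eig_eq by blast
qed

lemma Ym_add_left: "Ym (a + b) n u = Ym a n u + Ym b n u" 
  and Ym_scale_left: "Ym (sV c a) n u = sM c (Ym a n u)"
  using linear_Ym_left unfolding Vector_Spaces.linear_iff by blast+

lemma Ym_zero_left [simp]: "Ym 0 n u = 0"
  using Ym_add_left[of 0 0 n u] by simp

lemma Ym_sum_left: "Ym (sum f A) n u = (\<Sum>a\<in>A. Ym (f a) n u)"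
  by (induction A rule: infinite_finite_induct) (auto simp: Ym_add_left)

text \<open>Not an axiom for weak modules: it is the Borcherds identity for \<open>b = vac\<close>, \<open>p = 0\<close>, \<open>r = -2\<close>,
  since \<open>L_(-1) a = a_(-2) vac\<close>.\<close>
lemma translation: "Ym (Y om 0 a) n u = sM (- of_int n) (Ym a (n - 1) u)"
proof -
  interpret M: vector_space sM by (rule vector_space_M)
  have z: "Ym a n 0 = 0" for a n
    using linear_Ym[of a n] M.scale_zero_left unfolding Vector_Spaces.linear_iff by metis
  have "fsum (\<lambda>i::nat. sM (ibin 0 i) (Ym (Y a (-2 + int i) vac) (0 + n - int i) u)) = Ym (Y om 0 a) n u"
    by (subst fsum_eq_sum[of "{0}"]) (auto simp: ibin_zero_left translation_V)
  moreover have "fsum (\<lambda>i::nat. sM ((-1)^i * ibin (-2) i)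
            (Ym a (0 + -2 - int i) (Ym vac (n + int i) u)
             - sM (isign (-2)) (Ym vac (n + -2 - int i) (Ym a (0 + int i) u)))) = sM (- of_int n) (Ym a (n - 1) u)"
    (is "fsum ?g = _")
  proof -
    have pm: "(-1) ^ i * ((-1) ^ i * x) = (x :: complex)" for x and i :: nat
      by (simp add: mult.assoc[symmetric] power_mult_distrib[symmetric])
    \<comment> \<open>Only the vacuum mode -1 acts, which leaves i = -1 - n in the first product and
      i = n - 1 in the second. The first index is natural only for n < 0 and the second only for n >
      0, so for nonzero n exactly one survives, namely |n| - 1. Its coefficient i + 1 equals |n|,
      and the relative sign makes it -n in both cases.\<close>
    have g: "?g i = (if int i = -1 - n then sM (- of_int n) (Ym a (n - 1) u)
        else if int i = n - 1 then sM (- of_int n) (Ym a (n - 1) u) else 0)" for i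
    proof -
      have "of_nat (i + 1) = (- of_int n :: complex)" if "int i = -1 - n"
      proof -
        have "(of_nat i :: complex) = of_int (-1 - n)" using that by (metis of_int_of_nat_eq)
        then show ?thesis by simp
      qed
      moreover have "of_nat (i + 1) = (of_int n :: complex)" if "int i = n - 1"
      proof -
        have "(of_nat i :: complex) = of_int (n - 1)" using that by (metis of_int_of_nat_eq)
        then show ?thesis by simp
      qed
      ultimately show ?thesis
        by (auto simp: ibin_minus_two pm vacuum z isign_def M.scale_minus_left
            intro!: arg_cong2[of _ _ _ _ sM] arg_cong[of _ _ "\<lambda>m. Ym a m u"])
    qed
    show ?thesis
    proof (cases "n = 0")
      case True
      then show ?thesis unfolding g by simp
    next
      case False
      then have "fsum ?g = (\<Sum>i\<in>{nat (\<bar>n\<bar> - 1)}. sM (- of_int n) (Ym a (n - 1) u))"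
        unfolding g by (subst fsum_eq_sum[of "{nat (\<bar>n\<bar> - 1)}"]) auto
      then show ?thesis by simp
    qed
  qed
  ultimately show ?thesis using borcherds_M[of 0 a "-2" vac n u] by simp
qed

text \<open>The Borcherds identity for \<open>om\<close> with p = 1, r = 0 reads [L_0, a_(m)] =
  (L_(-1) a)_(m+1) + (L_0 a)_(m). The two terms contribute -(m + 1) and d.\<close>

lemma Ym_shifts:
  assumes "a \<in> V.ge d"
  shows "graded_space.shifts sM (Ym om 1) (Ym a m) (d - of_int m - 1)"
proof -
  interpret M: graded_space sM "Ym om 1" h "Suc K" by (rule graded_space_M)
  have L0: "Y om 1 a = sV d a" using assms by (simp add: gen_eigenspace_def)
  have "Ym om 1 (Ym a m u) = Ym a m (Ym om 1 u) + sM (d - of_int m - 1) (Ym a m u)" for u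
  proof -
    have "fsum (\<lambda>i::nat. sM (ibin 1 i) (Ym (Y om (0 + int i) a) (1 + m - int i) u))
      = Ym (Y om 0 a) (1 + m) u + Ym (Y om 1 a) m u"
      by (subst fsum_eq_sum[of "{0, 1}"]) (auto simp: ibin_one_left)
    moreover have "fsum (\<lambda>i::nat. sM ((-1)^i * ibin 0 i)
            (Ym om (1 + 0 - int i) (Ym a (m + int i) u)
             - sM (isign 0) (Ym a (m + 0 - int i) (Ym om (1 + int i) u)))) =
        Ym om 1 (Ym a m u) - Ym a m (Ym om 1 u)"
      by (subst fsum_eq_sum[of "{0}"]) (auto simp: ibin_zero_left isign_def)
    ultimately have "Ym om 1 (Ym a m u) - Ym a m (Ym om 1 u) = sM (- of_int (1 + m)) (Ym a m u) + sM d (Ym a m u)"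
      using borcherds_M[of 1 om 0 a m u] translation[of a "1 + m" u] by (simp add: L0 Ym_scale_left)
    also have "\<dots> = sM (d - of_int m - 1) (Ym a m u)"
      by (simp add: M.scale_left_distrib[symmetric])
    finally show ?thesis by (simp add: algebra_simps)
  qed
  then show ?thesis using linear_Ym by (simp add: M.shifts_def)
qed

abbreviation "\<theta> \<equiv> theta_act Y om sM Ym"

lemma theta_eq:
  assumes "a \<in> VD k"
  shows "\<theta> k a n u = sM ((-1) ^ k) (\<Sum>j\<le>k. sM (1 / of_nat (fact j)) (Ym ((Y om 2 ^^ j) a) (int k - int j - 1 - n) u))"
proof -
  interpret M: graded_space sM "Ym om 1" h "Suc K" by (rule graded_space_M)
  show ?thesis unfolding theta_act_def
    by (subst fsum_eq_sum[of "{..k}"]) (auto simp: L1_pow_zero[OF assms])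
qed

text \<open>L_1^j a has degree k - j and occurs in mode k - j - 1 - n, so every summand has the same
  weight n.\<close>

lemma theta_shifts:
  assumes "a \<in> VD k"
  shows "graded_space.shifts sM (Ym om 1) (\<theta> k a n) (of_int n)"
proof -
  interpret M: graded_space sM "Ym om 1" h "Suc K" by (rule graded_space_M)
  have B: "M.shifts (Ym ((Y om 2 ^^ j) a) (int k - int j - 1 - n)) (of_int n)" for j
    using Ym_shifts[OF L1_pow_ge[OF assms, of j], of "int k - int j - 1 - n"] by simp
  show ?thesis
    unfolding theta_eq[OF assms, abs_def] by (intro M.shifts_scale M.shifts_sum B)
qed

text \<open>Since n enters the modes with a minus sign, truncation now holds for very negative n.
  The minimum over the finitely many j up to k serves all summands.\<close>

lemma theta_truncation:
  assumes "a \<in> VD k" shows "\<exists>N. \<forall>n\<le>N. \<theta> k a n u = 0"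
proof -
  interpret M: vector_space sM by (rule vector_space_M)
  have "\<forall>j. \<exists>N. \<forall>n\<ge>N. Ym ((Y om 2 ^^ j) a) n u = 0" using truncation by blast
  then obtain f where f: "\<And>j n. n \<ge> f j \<Longrightarrow> Ym ((Y om 2 ^^ j) a) n u = 0" by metis
  define N where "N = Min ((\<lambda>j. int k - int j - 1 - f j) ` {..k})"
  have "\<theta> k a n u = 0" if "n \<le> N" for n
  proof -
    have "n \<le> int k - int j - 1 - f j" if "j \<le> k" for j
      using \<open>n \<le> N\<close> that unfolding N_def by (subst (asm) Min_ge_iff) auto
    then have "Ym ((Y om 2 ^^ j) a) (int k - int j - 1 - n) u = 0" if "j \<le> k" for j
      using f[of j "int k - int j - 1 - n"] that by fastforce
    then show ?thesis by (simp add: theta_eq[OF assms])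
  qed
  then show ?thesis by blast
qed

lemma theta_om: "\<theta> 2 om n u = Ym om (1 - n) u"
proof -
  interpret M: vector_space sM by (rule vector_space_M)
  have "\<theta> 2 om n u = (\<Sum>j\<le>2. sM (1 / of_nat (fact j)) (Ym ((Y om 2 ^^ j) om) (2 - int j - 1 - n) u))"
    by (simp add: theta_eq[OF om_VD])
  also have "\<dots> = Ym om (1 - n) u"
    by (simp add: eval_nat_numeral(2) L1_om L1_zero)
  finally show ?thesis .
qed

lemma theta_zero [simp]: "\<theta> k 0 n u = 0"
proof -
  interpret M: vector_space sM by (rule vector_space_M)
  have "(Y om 2 ^^ j) 0 = 0" for j by (induction j) (simp_all add: L1_zero)
  then show ?thesis by (simp add: theta_eq)
qed

text \<open>The other components of \<open>a\<close> are 0 and contribute \<phi> 0, whence the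
  second hypothesis.\<close>

lemma dual_act_homogeneous:
  assumes "a \<in> VD k" "\<phi> 0 = 0"
  shows "dual_act sV Y om sM Ym a m \<phi> u = \<phi> (\<theta> k a (m - int k + 1) u)"
  unfolding dual_act_def
  by (subst fsum_eq_sum[of "{k}"]) (auto simp: vcomp_homogeneous[OF assms(1)] assms(2))

end

section \<open>Conformal blocks\<close>

locale voa_triple = voa sV Y vac om
  for sV :: "complex \<Rightarrow> 'v::ab_group_add \<Rightarrow> 'v" and Y :: "'v \<Rightarrow> int \<Rightarrow> 'v \<Rightarrow> 'v" and vac om :: 'v +
  fixes s1 :: "complex \<Rightarrow> 'm1::ab_group_add \<Rightarrow> 'm1" and Y1 :: "'v \<Rightarrow> int \<Rightarrow> 'm1 \<Rightarrow> 'm1"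
    and s2 :: "complex \<Rightarrow> 'm2::ab_group_add \<Rightarrow> 'm2" and Y2 :: "'v \<Rightarrow> int \<Rightarrow> 'm2 \<Rightarrow> 'm2"
    and s3 :: "complex \<Rightarrow> 'm3::ab_group_add \<Rightarrow> 'm3" and Y3 :: "'v \<Rightarrow> int \<Rightarrow> 'm3 \<Rightarrow> 'm3"
    and h1 h2 h3 :: complex and k1 k2 k3 :: nat
  assumes Ck1: "is_Ck_module sV Y vac om s1 Y1 h1 k1"
    and Ck2: "is_Ck_module sV Y vac om s2 Y2 h2 k2"
    and Ck3: "is_Ck_module sV Y vac om s3 Y3 h3 k3"
begin

sublocale A1: voa_module sV Y vac om s1 Y1 h1 k1 by unfold_locales (rule Ck1)
sublocale A2: voa_module sV Y vac om s2 Y2 h2 k2 by unfold_locales (rule Ck2)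
sublocale A3: voa_module sV Y vac om s3 Y3 h3 k3 by unfold_locales (rule Ck3)

sublocale graded_triple s1 "Y1 om 1" h1 "Suc k1" s2 "Y2 om 1" h2 "Suc k2" s3 "Y3 om 1" h3 "Suc k3"
  by (intro graded_triple.intro A1.graded_space_M A2.graded_space_M A3.graded_space_M)

text \<open>The transpose on \<open>M^3\<close> of the action of \<open>a_(m)\<close> on \<open>D(M^3)\<close>, for \<open>a \<in> V_k\<close>.\<close>
definition adj :: "nat \<Rightarrow> 'v \<Rightarrow> int \<Rightarrow> 'm3 \<Rightarrow> 'm3" where
  "adj k a m = theta_act Y om s3 Y3 k a (m - int k + 1)"

lemma Y1_shifts: "a \<in> VD k \<Longrightarrow> M1.shifts (Y1 a m) (of_nat k - of_int m - 1)"
  and Y2_shifts: "a \<in> VD k \<Longrightarrow> M2.shifts (Y2 a m) (of_nat k - of_int m - 1)"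
  and adj_shifts: "a \<in> VD k \<Longrightarrow> M3.shifts (adj k a m) (of_int m - of_nat k + 1)"
  using A1.Ym_shifts[of a "of_nat k" m] A2.Ym_shifts[of a "of_nat k" m]
    A3.theta_shifts[of a k "m - int k + 1"]
  by (simp_all add: VD_iff adj_def)

lemma adj_truncation: "a \<in> VD k \<Longrightarrow> \<exists>N. \<forall>m\<le>N. adj k a m u = 0"
proof -
  assume "a \<in> VD k"
  then obtain N where "\<forall>n\<le>N. A3.\<theta> k a n u = 0" using A3.theta_truncation by blast
  then have "\<forall>m\<le>N + int k - 1. adj k a m u = 0" by (simp add: adj_def)
  then show ?thesis by blast
qed

text \<open>L_0 is its own transpose, which matches the third term of
  \<open>weight_op\<close>.\<close>

lemma adj_om: "adj 2 om 1 u = Y3 om 1 u"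
  by (simp add: adj_def A3.theta_om)

context
  fixes \<Phi> :: "'m1 \<Rightarrow> 'm2 \<Rightarrow> 'm3 \<Rightarrow> complex" and k :: nat and a :: 'v
  assumes tri: "trilinear \<Phi>" and a: "a \<in> VD k"
begin

lemma finite_modes1:
  assumes "\<forall>m<N. c m = 0" shows "finite {m. c m * \<Phi> (Y1 a m u1) u2 u3 \<noteq> 0}"
proof -
  obtain N' where N': "\<forall>n\<ge>N'. Y1 a n u1 = 0" using A1.truncation by blast
  show ?thesis by (rule finite_int_support[of N _ N']) (use assms N' in \<open>auto simp: trilinear_zeros[OF tri]\<close>)
qed

lemma finite_modes2:
  assumes "\<forall>m<N. c m = 0" shows "finite {m. c m * \<Phi> u1 (Y2 a m u2) u3 \<noteq> 0}"
proof -
  obtain N' where N': "\<forall>n\<ge>N'. Y2 a n u2 = 0" using A2.truncation by blast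
  show ?thesis by (rule finite_int_support[of N _ N']) (use assms N' in \<open>auto simp: trilinear_zeros[OF tri]\<close>)
qed

lemma finite_modes3:
  assumes "\<forall>m>N. c m = 0" shows "finite {m. c m * \<Phi> u1 u2 (adj k a m u3) \<noteq> 0}"
proof -
  obtain N' where N': "\<forall>n\<le>N'. adj k a n u3 = 0" using adj_truncation[OF a] by blast
  show ?thesis by (rule finite_int_support[of N' _ N]) (use assms N' in \<open>auto simp: trilinear_zeros[OF tri]\<close>)
qed

end

text \<open>\<open>c\<close>, \<open>d\<close>, \<open>e\<close> are the coefficients of a meromorphic function at \<open>0\<close>, \<open>1\<close> and \<open>\<infinity>\<close>.\<close>
definition pairing :: "('m1 \<Rightarrow> 'm2 \<Rightarrow> 'm3 \<Rightarrow> complex) \<Rightarrow> nat \<Rightarrow> 'v \<Rightarrow> (int \<Rightarrow> complex) \<Rightarrow>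
    (int \<Rightarrow> complex) \<Rightarrow> (int \<Rightarrow> complex) \<Rightarrow> 'm1 \<Rightarrow> 'm2 \<Rightarrow> 'm3 \<Rightarrow> complex" where
  "pairing \<Phi> k a c d e u1 u2 u3 =
    fsum (\<lambda>m. c m * \<Phi> (Y1 a m u1) u2 u3) + fsum (\<lambda>m. d m * \<Phi> u1 (Y2 a m u2) u3)
    - fsum (\<lambda>m. e m * \<Phi> u1 u2 (adj k a m u3))"

lemma pairing_generator:
  assumes tri: "trilinear \<Phi>" and a: "a \<in> VD k"
    and c: "\<forall>m<N1. c m = 0" and d: "\<forall>m<N2. d m = 0" and e: "\<forall>m>N3. e m = 0"
  shows "\<Phi> (fsum (\<lambda>m. s1 (c m) (Y1 a m u1))) u2 u3 + \<Phi> u1 (fsum (\<lambda>m. s2 (d m) (Y2 a m u2))) u3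
      + \<Phi> u1 u2 (- fsum (\<lambda>n. s3 (e (n + int k - 1)) (theta_act Y om s3 Y3 k a n u3)))
    = pairing \<Phi> k a c d e u1 u2 u3"
proof -
  obtain N1' where N1': "\<forall>n\<ge>N1'. Y1 a n u1 = 0" using A1.truncation by blast
  have 1: "finite {m. s1 (c m) (Y1 a m u1) \<noteq> 0}"
    by (rule finite_int_support[of N1 _ N1']) (use c N1' in auto)
  obtain N2' where N2': "\<forall>n\<ge>N2'. Y2 a n u2 = 0" using A2.truncation by blast
  have 2: "finite {m. s2 (d m) (Y2 a m u2) \<noteq> 0}"
    by (rule finite_int_support[of N2 _ N2']) (use d N2' in auto)
  obtain N3' where N3': "\<forall>n\<le>N3'. theta_act Y om s3 Y3 k a n u3 = 0"
    using A3.theta_truncation[OF a] by blast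
  let ?f = "\<lambda>n. s3 (e (n + int k - 1)) (theta_act Y om s3 Y3 k a n u3)"
  have 3: "finite {n. ?f n \<noteq> 0}"
    by (rule finite_int_support[of N3' _ "N3 - int k + 1"]) (use e N3' in auto)
  \<comment> \<open>The substitution m = n + k - 1 passes from the index of J_n(a) to that of the
    mode a_(m).\<close>
  have "fsum (\<lambda>m. e m * \<Phi> u1 u2 (adj k a m u3)) =
      fsum (\<lambda>n. e (n + int k - 1) * \<Phi> u1 u2 (adj k a (n + int k - 1) u3))"
  proof (rule fsum_reindex_inj)
    show "inj (\<lambda>n. n + int k - 1)" by (auto simp: inj_def)
    have "m \<in> range (\<lambda>n. n + int k - 1)" for m by (rule range_eqI[of _ _ "m - int k + 1"]) simp
    then show "m \<notin> range (\<lambda>n. n + int k - 1) \<Longrightarrow> e m * \<Phi> u1 u2 (adj k a m u3) = 0" for m by blast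
  qed
  also have "\<dots> = \<Phi> u1 u2 (fsum ?f)"
    by (subst M3.lin_form_fsum[OF trilinear3[OF tri] 3]) (simp add: trilinear_scale[OF tri] adj_def)
  finally have "\<Phi> u1 u2 (- fsum ?f) = - fsum (\<lambda>m. e m * \<Phi> u1 u2 (adj k a m u3))"
    using M3.lin_form_minus[OF trilinear3[OF tri]] by simp
  then show ?thesis
    unfolding pairing_def M1.lin_form_fsum[OF trilinear1[OF tri] 1] M2.lin_form_fsum[OF trilinear2[OF tri] 2]
    by (simp add: trilinear_scale[OF tri])
qed

lemma pairing_sum:
  assumes tri: "trilinear \<Phi>" and a: "a \<in> VD k" and J: "finite J"
    and c: "\<And>j. \<exists>N. \<forall>m<N. c j m = 0" and d: "\<And>j. \<exists>N. \<forall>m<N. d j m = 0" and e: "\<And>j. \<exists>N. \<forall>m>N. e j m = 0"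
  shows "pairing \<Phi> k a (\<lambda>m. \<Sum>j\<in>J. r j * c j m) (\<lambda>m. \<Sum>j\<in>J. r j * d j m) (\<lambda>m. \<Sum>j\<in>J. r j * e j m) u1 u2 u3
    = (\<Sum>j\<in>J. r j * pairing \<Phi> k a (c j) (d j) (e j) u1 u2 u3)"
proof -
  have 1: "finite {m. r j * (c j m * \<Phi> (Y1 a m u1) u2 u3) \<noteq> 0}" for j
    using c[of j] finite_modes1[OF tri a] by (intro finite_support_scale) blast
  have 2: "finite {m. r j * (d j m * \<Phi> u1 (Y2 a m u2) u3) \<noteq> 0}" for j
    using d[of j] finite_modes2[OF tri a] by (intro finite_support_scale) blast
  have 3: "finite {m. r j * (e j m * \<Phi> u1 u2 (adj k a m u3)) \<noteq> 0}" for j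
    using e[of j] finite_modes3[OF tri a] by (intro finite_support_scale) blast
  show ?thesis
    unfolding pairing_def sum_distrib_right mult.assoc fsum_sum[OF J 1] fsum_sum[OF J 2]
      fsum_sum[OF J 3] fsum_mult
    by (simp add: distrib_left right_diff_distrib sum.distrib sum_subtractf)
qed

text \<open>The summands of the Borcherds-type identity attached to \<open>z\<^sup>p (z - 1)\<^sup>q\<close>.\<close>
definition jacobi_term :: "nat \<Rightarrow> 'v \<Rightarrow> int \<Rightarrow> int \<Rightarrow> ('m1 \<Rightarrow> 'm2 \<Rightarrow> 'm3 \<Rightarrow> complex) \<Rightarrow> nat \<Rightarrow>
    'm1 \<Rightarrow> 'm2 \<Rightarrow> 'm3 \<Rightarrow> complex" where
  "jacobi_term k a p q \<Phi> i = (\<lambda>u1 u2 u3. ibin p i * \<Phi> u1 (Y2 a (q + int i) u2) u3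
     - (-1) ^ i * ibin q i * (\<Phi> u1 u2 (adj k a (p + q - int i) u3)
        - isign q * \<Phi> (Y1 a (p + int i) u1) u2 u3))"

context
  fixes \<Phi> :: "'m1 \<Rightarrow> 'm2 \<Rightarrow> 'm3 \<Rightarrow> complex" and k :: nat and a :: 'v
  assumes tri: "trilinear \<Phi>" and a: "a \<in> VD k"
begin

lemma finite_jac1: "finite {i::nat. c i * \<Phi> (Y1 a (p + int i) u1) u2 u3 \<noteq> 0}"
proof -
  obtain N where "\<forall>n\<ge>N. Y1 a n u1 = 0" using A1.truncation by blast
  then show ?thesis by (intro finite_nat_support[of "nat (N - p)"]) (simp add: trilinear_zeros[OF tri])
qed

lemma finite_jac2: "finite {i::nat. c i * \<Phi> u1 (Y2 a (q + int i) u2) u3 \<noteq> 0}"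
proof -
  obtain N where "\<forall>n\<ge>N. Y2 a n u2 = 0" using A2.truncation by blast
  then show ?thesis by (intro finite_nat_support[of "nat (N - q)"]) (simp add: trilinear_zeros[OF tri])
qed

lemma finite_jac3: "finite {i::nat. c i * \<Phi> u1 u2 (adj k a (r - int i) u3) \<noteq> 0}"
proof -
  obtain N where "\<forall>n\<le>N. adj k a n u3 = 0" using adj_truncation[OF a] by blast
  then show ?thesis by (intro finite_nat_support[of "nat (r - N)"]) (simp add: trilinear_zeros[OF tri])
qed

lemma locally_finite_jacobi_term: "locally_finite (jacobi_term k a p q \<Phi>)"
  unfolding locally_finite_def jacobi_term_def right_diff_distrib mult.assoc[symmetric]
  by (intro allI finite_support_diff finite_jac1 finite_jac2 finite_jac3)

text \<open>Each summand is a combination of pullbacks along operators of known weight, so the rules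
  for \<open>log_coeff\<close> apply term by term.\<close>

lemma jacobi_term_eq: "jacobi_term k a p q \<Phi> i = (\<lambda>u1 u2 u3. ibin p i * pull2 (Y2 a (q + int i)) \<Phi> u1 u2 u3 +
    (- ((-1) ^ i * ibin q i)) * (1 * pull3 (adj k a (p + q - int i)) \<Phi> u1 u2 u3 +
      (- isign q) * pull1 (Y1 a (p + int i)) \<Phi> u1 u2 u3))"
  by (simp add: jacobi_term_def pull_defs)

lemmas trilinear_modes = trilinear_pull(1)[OF tri Y1_shifts[OF a]]
  trilinear_pull(2)[OF tri Y2_shifts[OF a]] trilinear_pull(3)[OF tri adj_shifts[OF a]]

lemma trilinear_jacobi_term: "trilinear (jacobi_term k a p q \<Phi> i)"
  unfolding jacobi_term_eq by (intro trilinear_lincomb trilinear_modes)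

text \<open>Each expansion is reindexed by the distance i from its leading exponent: m = p + i at 0,
  m = q + i at 1 and m = p + q - i at infinity.\<close>

lemma pairing_binomial:
  "pairing \<Phi> k a (fls_nth (binomial_fls fls_X p q)) (fls_nth (binomial_fls (fls_X + 1) p q))
    (\<lambda>m. fls_nth (binomial_fls (inverse fls_X) p q) (- m)) u1 u2 u3 = form_sum (jacobi_term k a p q \<Phi>) u1 u2 u3"
proof -
  have 1: "fsum (\<lambda>m. fls_nth (binomial_fls fls_X p q) m * \<Phi> (Y1 a m u1) u2 u3) =
      fsum (\<lambda>i::nat. (-1) ^ i * ibin q i * isign q * \<Phi> (Y1 a (p + int i) u1) u2 u3)"
  proof (subst fsum_reindex_inj[of "\<lambda>i::nat. p + int i"])
    show "fls_nth (binomial_fls fls_X p q) m * \<Phi> (Y1 a m u1) u2 u3 = 0" if "m \<notin> range (\<lambda>i::nat. p + int i)" for m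
    proof -
      have "m < p"
      proof (rule ccontr)
        assume "\<not> m < p"
        then have "m = p + int (nat (m - p))" by simp
        then show False using that by blast
      qed
      then show ?thesis by (simp add: nth_binomial_fls_0)
    qed
  qed (auto simp: nth_binomial_fls_0 inj_def ac_simps)
  have 2: "fsum (\<lambda>m. fls_nth (binomial_fls (fls_X + 1) p q) m * \<Phi> u1 (Y2 a m u2) u3) =
      fsum (\<lambda>i::nat. ibin p i * \<Phi> u1 (Y2 a (q + int i) u2) u3)"
  proof (subst fsum_reindex_inj[of "\<lambda>i::nat. q + int i"])
    show "fls_nth (binomial_fls (fls_X + 1) p q) m * \<Phi> u1 (Y2 a m u2) u3 = 0" if "m \<notin> range (\<lambda>i::nat. q + int i)" for m
    proof -
      have "m < q"
      proof (rule ccontr)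
        assume "\<not> m < q"
        then have "m = q + int (nat (m - q))" by simp
        then show False using that by blast
      qed
      then show ?thesis by (simp add: nth_binomial_fls_1)
    qed
  qed (auto simp: nth_binomial_fls_1 inj_def)
  have nth: "fls_nth (binomial_fls (inverse fls_X) p q) (int i - (p + q)) = (-1) ^ i * ibin q i" for i
    using nth_binomial_fls_infinity[of p q "p + q - int i"] by simp
  have 3: "fsum (\<lambda>m. fls_nth (binomial_fls (inverse fls_X) p q) (- m) * \<Phi> u1 u2 (adj k a m u3)) =
      fsum (\<lambda>i::nat. (-1) ^ i * ibin q i * \<Phi> u1 u2 (adj k a (p + q - int i) u3))"
  proof (subst fsum_reindex_inj[of "\<lambda>i::nat. p + q - int i"])
    show "fls_nth (binomial_fls (inverse fls_X) p q) (- m) * \<Phi> u1 u2 (adj k a m u3) = 0"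
      if "m \<notin> range (\<lambda>i::nat. p + q - int i)" for m
    proof -
      have "p + q < m"
      proof (rule ccontr)
        assume "\<not> p + q < m"
        then have "m = p + q - int (nat (p + q - m))" by simp
        then show False using that by blast
      qed
      then show ?thesis by (simp add: nth_binomial_fls_infinity)
    qed
  qed (auto simp: nth inj_def)
  show ?thesis
    unfolding pairing_def 1 2 3 form_sum_def jacobi_term_def right_diff_distrib mult.assoc[symmetric]
    by (subst fsum_diff, (intro finite_support_diff finite_jac1 finite_jac2 finite_jac3)+,
        subst fsum_diff, (intro finite_jac1 finite_jac3)+) simp
qed

text \<open>On M^1 and M^2 the mode m of a in V_k has weight k - m - 1, and its transpose on M^3 has
  the opposite weight. The total weight on the left is chosen so that these shifts produce the
  exponents of the Borcherds identity at \<alpha>, each increased by 1 because the exponent \<alpha>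
  belongs to weight \<alpha> + 1.\<close>

lemma log_coeff_jacobi_term:
  "log_coeff n (\<alpha> + of_int p + of_int q - of_nat k + 2) (form_sum (jacobi_term k a p q \<Phi>)) u1 u2 u3 =
    fsum (\<lambda>i::nat. ibin p i * log_coeff n (\<alpha> + of_int p - of_nat i + 1) \<Phi> u1 (Y2 a (q + int i) u2) u3
     - (-1) ^ i * ibin q i * (log_coeff n (\<alpha> + of_nat i + 1) \<Phi> u1 u2 (adj k a (p + q - int i) u3)
        - isign q * log_coeff n (\<alpha> + of_int q - of_nat i + 1) \<Phi> (Y1 a (p + int i) u1) u2 u3))"
proof -
  let ?w = "\<alpha> + of_int p + of_int q - of_nat k + 2"
  have "log_coeff n ?w (jacobi_term k a p q \<Phi> i) = (\<lambda>u1 u2 u3. ibin p i * log_coeff n (\<alpha> + of_int p - of_nat i + 1) \<Phi> u1 (Y2 a (q + int i) u2) u3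
     - (-1) ^ i * ibin q i * (log_coeff n (\<alpha> + of_nat i + 1) \<Phi> u1 u2 (adj k a (p + q - int i) u3)
        - isign q * log_coeff n (\<alpha> + of_int q - of_nat i + 1) \<Phi> (Y1 a (p + int i) u1) u2 u3))" for i
  proof -
    have e: "?w + (of_nat k - of_int (q + int i) - 1) = \<alpha> + of_int p - of_nat i + 1"
      "?w - (of_int (p + q - int i) - of_nat k + 1) = \<alpha> + of_nat i + 1"
      "?w + (of_nat k - of_int (p + int i) - 1) = \<alpha> + of_int q - of_nat i + 1"
      by (simp_all add: algebra_simps)
    show ?thesis
      unfolding jacobi_term_eq log_coeff_lincomb[OF trilinear_modes(2) trilinear_lincomb[OF trilinear_modes(3,1)]]
        log_coeff_lincomb[OF trilinear_modes(3,1)]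
        log_coeff_pull1[OF tri Y1_shifts[OF a]] log_coeff_pull2[OF tri Y2_shifts[OF a]] log_coeff_pull3[OF tri adj_shifts[OF a]] e
      by (simp add: pull_defs)
  qed
  then show ?thesis
    using log_coeff_form_sum[OF locally_finite_jacobi_term trilinear_jacobi_term] by (simp add: form_sum_def)
qed

end

section \<open>Conformal blocks as solutions of Borcherds-type identities\<close>

abbreviation "blocks \<equiv> conformal_blocks sV Y om s1 Y1 s2 Y2 s3 Y3"
abbreviation "intertwiners \<equiv> log_intertwiners sV Y om s1 Y1 s2 Y2 s3 Y3 h3 k3"

lemma fls_bounded: "\<exists>N. \<forall>m<N. fls_nth f m = 0" "\<exists>N. \<forall>m>N. fls_nth f (- m) = 0"
proof -
  show "\<exists>N. \<forall>m<N. fls_nth f m = 0" by (intro exI[of _ "fls_subdegree f"]) simp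
  show "\<exists>N. \<forall>m>N. fls_nth f (- m) = 0" by (intro exI[of _ "- fls_subdegree f"]) simp
qed

lemma generator_pairing:
  assumes "trilinear \<Phi>" "a \<in> VD k"
  shows "\<Phi> (fsum (\<lambda>m. s1 (exp0 p \<alpha> \<beta> m) (Y1 a m u1))) u2 u3
          + \<Phi> u1 (fsum (\<lambda>m. s2 (exp1 p \<alpha> \<beta> m) (Y2 a m u2))) u3
          + \<Phi> u1 u2 (- fsum (\<lambda>n. s3 (expinf p \<alpha> \<beta> (n + int k - 1)) (theta_act Y om s3 Y3 k a n u3)))
    = pairing \<Phi> k a (exp0 p \<alpha> \<beta>) (exp1 p \<alpha> \<beta>) (expinf p \<alpha> \<beta>) u1 u2 u3"
proof -
  have "\<exists>N. \<forall>m<N. exp0 p \<alpha> \<beta> m = 0" "\<exists>N. \<forall>m<N. exp1 p \<alpha> \<beta> m = 0" "\<exists>N. \<forall>m>N. expinf p \<alpha> \<beta> m = 0"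
    unfolding exp0_def exp1_def expinf_def by (rule fls_bounded)+
  then show ?thesis using pairing_generator[OF assms] by blast
qed

text \<open>The binomials are themselves test functions by \<open>fexp_binomial\<close>, and they
  span all test functions by \<open>fexp_expand\<close>.\<close>

lemma blocks_iff:
  "\<Phi> \<in> blocks \<longleftrightarrow> trilinear \<Phi> \<and>
    (\<forall>k a p q. a \<in> VD k \<longrightarrow> form_sum (jacobi_term k a p q \<Phi>) = (\<lambda>u1 u2 u3. 0))" (is "_ \<longleftrightarrow> ?r")
proof
  assume \<Phi>: "\<Phi> \<in> blocks"
  have tri: "trilinear \<Phi>"
    using \<Phi> unfolding conformal_blocks_def trilinear_def M1.linear_cscale M2.linear_cscale M3.linear_cscale
    by blast
  have "form_sum (jacobi_term k a p q \<Phi>) u1 u2 u3 = 0" if a: "a \<in> VD k" for k a p q u1 u2 u3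
  proof -
    let ?f = "[:0, 1:] ^ nat p * [:-1, 1:] ^ nat q" and ?\<alpha> = "nat (- p)" and ?\<beta> = "nat (- q)"
    have "pairing \<Phi> k a (exp0 ?f ?\<alpha> ?\<beta>) (exp1 ?f ?\<alpha> ?\<beta>) (expinf ?f ?\<alpha> ?\<beta>) u1 u2 u3 = 0"
      using \<Phi> a unfolding generator_pairing[OF tri a, symmetric] conformal_blocks_def by blast
    moreover have "exp0 ?f ?\<alpha> ?\<beta> = fls_nth (binomial_fls fls_X p q)"
      "exp1 ?f ?\<alpha> ?\<beta> = fls_nth (binomial_fls (fls_X + 1) p q)"
      "expinf ?f ?\<alpha> ?\<beta> = (\<lambda>m. fls_nth (binomial_fls (inverse fls_X) p q) (- m))"
      by (intro ext, simp only: exp0_def exp1_def expinf_def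
          fexp_binomial[OF expansion_points(1,2)] fexp_binomial[OF expansion_points(3,4)]
          fexp_binomial[OF expansion_points(5,6)])+
    ultimately show ?thesis using pairing_binomial[OF tri a] by simp
  qed
  then show ?r using tri by blast
next
  assume r: ?r
  then have tri: "trilinear \<Phi>" by blast
  have "pairing \<Phi> k a (exp0 p \<alpha> \<beta>) (exp1 p \<alpha> \<beta>) (expinf p \<alpha> \<beta>) u1 u2 u3 = 0"
    if a: "a \<in> VD k" for k a p \<alpha> \<beta> u1 u2 u3
  proof -
    let ?b = "\<lambda>Z j. binomial_fls Z (int j - int \<alpha>) (- int \<beta>)"
    have "exp0 p \<alpha> \<beta> = (\<lambda>m. \<Sum>j\<le>degree p. coeff p j * fls_nth (?b fls_X j) m)"
      "exp1 p \<alpha> \<beta> = (\<lambda>m. \<Sum>j\<le>degree p. coeff p j * fls_nth (?b (fls_X + 1) j) m)"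
      "expinf p \<alpha> \<beta> = (\<lambda>m. \<Sum>j\<le>degree p. coeff p j * fls_nth (?b (inverse fls_X) j) (- m))"
      by (intro ext, simp only: exp0_def exp1_def expinf_def fexp_expand[OF expansion_points(1,2)]
          fexp_expand[OF expansion_points(3,4)] fexp_expand[OF expansion_points(5,6)])+
    then show ?thesis
      using r a by (simp add: pairing_sum[OF tri a] fls_bounded pairing_binomial[OF tri a])
  qed
  then show "\<Phi> \<in> blocks"
    using tri generator_pairing[OF tri]
    unfolding conformal_blocks_def trilinear_def M1.linear_cscale M2.linear_cscale M3.linear_cscale
    by simp
qed

end

section \<open>Logarithmic intertwining operators\<close>

lemma vector_space_forms:
  "vector_space (\<lambda>(c::complex) (f::'a \<Rightarrow> complex) x. c * f x)"
  "vector_space (\<lambda>(c::complex) (f::'a \<Rightarrow> 'b \<Rightarrow> complex) x y. c * f x y)"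
  by (unfold_locales; simp add: fun_eq_iff algebra_simps)+

context voa_triple
begin

text \<open>The difference of the two sides of axiom (iii) for a in V_k, with the action on D(M^3)
  moved to M^3. It has the shape of \<open>jacobi_term\<close>, except that each form carries its
  own exponent.\<close>

definition jacobi :: "(nat \<Rightarrow> complex \<Rightarrow> 'm1 \<Rightarrow> 'm2 \<Rightarrow> 'm3 \<Rightarrow> complex) \<Rightarrow> nat \<Rightarrow> 'v \<Rightarrow> int \<Rightarrow> int \<Rightarrow>
    nat \<Rightarrow> complex \<Rightarrow> 'm1 \<Rightarrow> 'm2 \<Rightarrow> 'm3 \<Rightarrow> complex" where
  "jacobi J k a p q n \<alpha> u1 u2 u3 =
    fsum (\<lambda>i::nat. ibin p i * J n (\<alpha> + of_int p - of_nat i) u1 (Y2 a (q + int i) u2) u3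
     - (-1) ^ i * ibin q i * (J n (\<alpha> + of_nat i) u1 u2 (adj k a (p + q - int i) u3)
        - isign q * J n (\<alpha> + of_int q - of_nat i) (Y1 a (p + int i) u1) u2 u3))"

lemma jacobi_log_coeff:
  assumes "trilinear \<Phi>" "a \<in> VD k"
  shows "jacobi (\<lambda>n \<alpha>. log_coeff n (\<alpha> + 1) \<Phi>) k a p q n \<alpha> u1 u2 u3 =
    log_coeff n (\<alpha> + of_int p + of_int q - of_nat k + 2) (form_sum (jacobi_term k a p q \<Phi>)) u1 u2 u3"
  by (simp only: jacobi_def log_coeff_jacobi_term[OF assms])

text \<open>For p = 1, q = 0 only i = 0 and i = 1 remain. The three L_0 terms add up to T, here
  written as (T - \<alpha> - 1) + (\<alpha> + 1), and one L_(-1) term is left over.\<close>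

lemma jacobi_om:
  "jacobi J 2 om 1 0 n \<alpha> u1 u2 u3 = J n (\<alpha> + 1) u1 (Y2 om 0 u2) u3
    + weight_op (\<alpha> + 1) (J n \<alpha>) u1 u2 u3 + (\<alpha> + 1) * J n \<alpha> u1 u2 u3"
  unfolding jacobi_def
  by (subst fsum_eq_sum[of "{0, 1}"]) (auto simp: ibin_one_left ibin_zero_left isign_def adj_om weight_op_def)

text \<open>Axiom (iii) for an arbitrary \<open>a\<close>, kept apart from \<open>jacobi\<close>,
  which makes sense only with a chosen degree k.\<close>

definition borcherds_identity :: "(nat \<Rightarrow> complex \<Rightarrow> 'm1 \<Rightarrow> 'm2 \<Rightarrow> 'm3 \<Rightarrow> complex) \<Rightarrow> 'v \<Rightarrow> int \<Rightarrow> int \<Rightarrow> nat \<Rightarrow> complex \<Rightarrow> 'm1 \<Rightarrow> 'm2 \<Rightarrow> 'm3 \<Rightarrow> bool" where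
  "borcherds_identity J a p q n \<alpha> u1 u2 u3 \<longleftrightarrow>
    fsum (\<lambda>i::nat. (ibin p i * J n (\<alpha> + of_int p - of_nat i) u1 (Y2 a (q + int i) u2) u3))
    = fsum (\<lambda>i::nat. ((-1) ^ i * ibin q i *
                 (dual_act sV Y om s3 Y3 a (p + q - int i) (J n (\<alpha> + of_nat i) u1 u2) u3
                  - isign q * J n (\<alpha> + of_int q - of_nat i) (Y1 a (p + int i) u1) u2 u3)))"

context
  fixes J :: "nat \<Rightarrow> complex \<Rightarrow> 'm1 \<Rightarrow> 'm2 \<Rightarrow> 'm3 \<Rightarrow> complex"
  assumes tri: "\<And>n \<alpha>. trilinear (J n \<alpha>)"
begin

lemma finite_jacobi1: "finite {i::nat. ibin p i * J n (\<alpha> + of_int p - of_nat i) u1 (Y2 a (q + int i) u2) u3 \<noteq> 0}"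
proof -
  obtain N where "\<forall>n\<ge>N. Y2 a n u2 = 0" using A2.truncation by blast
  then show ?thesis by (intro finite_nat_support[of "nat (N - q)"]) (simp add: trilinear_zeros[OF tri])
qed

lemma finite_jacobi2:
  assumes "a \<in> VD k"
  shows "finite {i::nat. (-1) ^ i * ibin q i * (J n (\<alpha> + of_nat i) u1 u2 (adj k a (p + q - int i) u3)
        - isign q * J n (\<alpha> + of_int q - of_nat i) (Y1 a (p + int i) u1) u2 u3) \<noteq> 0}"
proof -
  obtain N N' where "\<forall>n\<le>N. adj k a n u3 = 0" "\<forall>n\<ge>N'. Y1 a n u1 = 0"
    using adj_truncation[OF assms] A1.truncation by blast
  then show ?thesis
    by (intro finite_nat_support[of "nat (p + q - N) + nat (N' - p)"]) (simp add: trilinear_zeros[OF tri])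
qed

lemma jacobi_split:
  assumes "a \<in> VD k"
  shows "jacobi J k a p q n \<alpha> u1 u2 u3 =
    fsum (\<lambda>i::nat. ibin p i * J n (\<alpha> + of_int p - of_nat i) u1 (Y2 a (q + int i) u2) u3) -
    fsum (\<lambda>i::nat. (-1) ^ i * ibin q i * (J n (\<alpha> + of_nat i) u1 u2 (adj k a (p + q - int i) u3)
        - isign q * J n (\<alpha> + of_int q - of_nat i) (Y1 a (p + int i) u1) u2 u3))"
  unfolding jacobi_def by (rule fsum_diff[OF finite_jacobi1 finite_jacobi2[OF assms]])

lemma borcherds_identity_homogeneous:
  assumes "a \<in> VD k"
  shows "borcherds_identity J a p q n \<alpha> u1 u2 u3 \<longleftrightarrow> jacobi J k a p q n \<alpha> u1 u2 u3 = 0"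
proof -
  have "dual_act sV Y om s3 Y3 a m (J n \<beta> u1 u2) u3 = J n \<beta> u1 u2 (adj k a m u3)" for \<beta> m u1 u2 u3
    unfolding adj_def by (rule A3.dual_act_homogeneous[OF assms]) (rule trilinear_zeros(3)[OF tri])
  then show ?thesis by (simp add: borcherds_identity_def jacobi_split[OF assms])
qed

text \<open>Both sides are additive over the decomposition \<open>vcomp\<close>, the same one that
  defines \<open>dual_act\<close>, so homogeneous elements suffice.\<close>

lemma borcherds_identityI:
  assumes "\<And>k a. a \<in> VD k \<Longrightarrow> jacobi J k a p q n \<alpha> u1 u2 u3 = 0"
  shows "borcherds_identity J a p q n \<alpha> u1 u2 u3"
proof -
  define c where "c = vcomp sV Y om a"
  define S where "S = {k. c k \<noteq> 0}"
  have S: "finite S" and c: "c k \<in> VD k" and a: "a = sum c S" for k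
    unfolding S_def c_def by (rule finite_vcomp vcomp_VD sum_vcomp)+
  have Y1: "J n \<beta> (Y1 a m u1) u2 u3 = (\<Sum>k\<in>S. J n \<beta> (Y1 (c k) m u1) u2 u3)" for \<beta> m u1 u2 u3
    by (simp add: a A1.Ym_sum_left M1.lin_form_sum[OF trilinear1[OF tri]])
  have Y2: "J n \<beta> u1 (Y2 a m u2) u3 = (\<Sum>k\<in>S. J n \<beta> u1 (Y2 (c k) m u2) u3)" for \<beta> m u1 u2 u3
    by (simp add: a A2.Ym_sum_left M2.lin_form_sum[OF trilinear2[OF tri]])
  have Y3: "dual_act sV Y om s3 Y3 a m (J n \<beta> u1 u2) u3 = (\<Sum>k\<in>S. J n \<beta> u1 u2 (adj k (c k) m u3))" for \<beta> m u1 u2 u3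
    unfolding dual_act_def adj_def c_def[symmetric]
    by (rule fsum_eq_sum[OF S]) (simp add: S_def trilinear_zeros[OF tri])
  let ?l = "\<lambda>k i::nat. ibin p i * J n (\<alpha> + of_int p - of_nat i) u1 (Y2 (c k) (q + int i) u2) u3"
  let ?r = "\<lambda>k i::nat. (-1) ^ i * ibin q i * (J n (\<alpha> + of_nat i) u1 u2 (adj k (c k) (p + q - int i) u3)
        - isign q * J n (\<alpha> + of_int q - of_nat i) (Y1 (c k) (p + int i) u1) u2 u3)"
  have "fsum (?l k) = fsum (?r k)" for k
    using assms[OF c, of k] by (simp add: jacobi_split[OF c])
  then have "fsum (\<lambda>i. \<Sum>k\<in>S. ?l k i) = fsum (\<lambda>i. \<Sum>k\<in>S. ?r k i)"
    by (simp add: fsum_sum[OF S finite_jacobi1] fsum_sum[OF S finite_jacobi2[OF c]])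
  moreover have "(\<Sum>k\<in>S. ?l k i) = ibin p i * J n (\<alpha> + of_int p - of_nat i) u1 (Y2 a (q + int i) u2) u3" for i
    by (simp add: Y2 sum_distrib_left)
  moreover have "(\<Sum>k\<in>S. ?r k i) = (-1) ^ i * ibin q i *
      (dual_act sV Y om s3 Y3 a (p + q - int i) (J n (\<alpha> + of_nat i) u1 u2) u3
        - isign q * J n (\<alpha> + of_int q - of_nat i) (Y1 a (p + int i) u1) u2 u3)" for i
    by (simp add: Y1 Y3 sum_distrib_left sum_subtractf right_diff_distrib)
  ultimately show ?thesis unfolding borcherds_identity_def by simp
qed

end

text \<open>The axioms in terms of forms: the three linearity conditions merge into
  \<open>trilinear\<close>, and axiom (iii) is restricted to homogeneous elements.\<close>

lemma mem_intertwiners: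
  "(\<lambda>n \<alpha> u2 u1 u3. J n \<alpha> u1 u2 u3) \<in> intertwiners \<longleftrightarrow>
    (\<exists>d. \<forall>n>d. \<forall>\<alpha>. J n \<alpha> = (\<lambda>u1 u2 u3. 0)) \<and> (\<forall>n \<alpha>. trilinear (J n \<alpha>)) \<and>
    (\<forall>n \<alpha> u2 u1. \<exists>N. \<forall>m>N. \<forall>u3\<in>M3.ge (h3 + of_nat m). J n \<alpha> u1 u2 u3 = 0) \<and>
    (\<forall>u2 u1 n. \<exists>R. \<forall>\<alpha>. Re \<alpha> > R \<longrightarrow> J n \<alpha> u1 u2 = (\<lambda>u3. 0)) \<and>
    (\<forall>n \<alpha> u2 u1 u3. J n \<alpha> u1 (Y2 om 0 u2) u3 = - \<alpha> * J n (\<alpha> - 1) u1 u2 u3 + of_nat (n + 1) * J (n + 1) (\<alpha> - 1) u1 u2 u3) \<and>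
    (\<forall>k a n \<alpha> p q u1 u2 u3. a \<in> VD k \<longrightarrow> jacobi J k a p q n \<alpha> u1 u2 u3 = 0)" (is "?l \<longleftrightarrow> ?r")
proof -
  have tri: "(\<forall>n \<alpha> u2 u1. Vector_Spaces.linear s3 cscale (J n \<alpha> u1 u2)) \<and>
      (\<forall>n \<alpha> u2. Vector_Spaces.linear s1 (\<lambda>c f x. c * f x) (\<lambda>u1 u3. J n \<alpha> u1 u2 u3)) \<and>
      (\<forall>n \<alpha>. Vector_Spaces.linear s2 (\<lambda>c f x y. c * f x y) (\<lambda>u2 u1 u3. J n \<alpha> u1 u2 u3))
      \<longleftrightarrow> (\<forall>n \<alpha>. trilinear (J n \<alpha>))"
    unfolding Vector_Spaces.linear_iff[of s1] Vector_Spaces.linear_iff[of s2] M3.linear_cscale trilinear_def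
    by (simp add: lin_form_def fun_eq_iff M1.vector_space_axioms M2.vector_space_axioms vector_space_forms)
      (rule iffI; simp)
  have jacobi_term: "(\<forall>a u2 u1 \<alpha> n p q u3. borcherds_identity J a p q n \<alpha> u1 u2 u3) \<longleftrightarrow>
      (\<forall>k a n \<alpha> p q u1 u2 u3. a \<in> VD k \<longrightarrow> jacobi J k a p q n \<alpha> u1 u2 u3 = 0)" if "\<And>n \<alpha>. trilinear (J n \<alpha>)"
    using borcherds_identity_homogeneous[OF that] borcherds_identityI[OF that] by meson
  have zero: "(\<lambda>u2 u1 u3. J n \<alpha> u1 u2 u3) = (\<lambda>u2 u1 u3. 0) \<longleftrightarrow> J n \<alpha> = (\<lambda>u1 u2 u3. 0)" for n \<alpha>
    by (auto simp: fun_eq_iff)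
  have eq: "?l \<longleftrightarrow> (\<exists>d. \<forall>n>d. \<forall>\<alpha>. J n \<alpha> = (\<lambda>u1 u2 u3. 0)) \<and>
    ((\<forall>n \<alpha> u2 u1. Vector_Spaces.linear s3 cscale (J n \<alpha> u1 u2)) \<and>
      (\<forall>n \<alpha> u2. Vector_Spaces.linear s1 (\<lambda>c f x. c * f x) (\<lambda>u1 u3. J n \<alpha> u1 u2 u3)) \<and>
      (\<forall>n \<alpha>. Vector_Spaces.linear s2 (\<lambda>c f x y. c * f x y) (\<lambda>u2 u1 u3. J n \<alpha> u1 u2 u3))) \<and>
    (\<forall>n \<alpha> u2 u1. \<exists>N. \<forall>m>N. \<forall>u3\<in>M3.ge (h3 + of_nat m). J n \<alpha> u1 u2 u3 = 0) \<and>
    (\<forall>u2 u1 n. \<exists>R. \<forall>\<alpha>. Re \<alpha> > R \<longrightarrow> J n \<alpha> u1 u2 = (\<lambda>u3. 0)) \<and>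
    (\<forall>n \<alpha> u2 u1 u3. J n \<alpha> u1 (Y2 om 0 u2) u3 = - \<alpha> * J n (\<alpha> - 1) u1 u2 u3 + of_nat (n + 1) * J (n + 1) (\<alpha> - 1) u1 u2 u3) \<and>
    (\<forall>a u2 u1 \<alpha> n p q u3. borcherds_identity J a p q n \<alpha> u1 u2 u3)"
    unfolding log_intertwiners_def mem_Collect_eq zero restricted_dual_def A3.gen_eig_eq borcherds_identity_def
      zero_fun_def fun_eq_iff[of "\<lambda>u1 u3. J _ _ u1 (Y2 om 0 _) u3"] Suc_eq_plus1
    by (simp only: fun_eq_iff all_conj_distrib conj_ac)
  \<comment> \<open>Reducing axiom (iii) to homogeneous elements relies on trilinearity. If that
    fails, both sides of the equivalence are false.\<close>
  show ?thesis
  proof (cases "\<forall>n \<alpha>. trilinear (J n \<alpha>)")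
    case True
    then show ?thesis unfolding eq tri by (subst jacobi_term) simp_all
  next
    case False
    then show ?thesis unfolding eq tri by (simp only: simp_thms)
  qed
qed

section \<open>From conformal blocks to intertwining operators and back\<close>

lemma concentrated_bound:
  obtains R where "\<And>w \<Phi> u3. trilinear \<Phi> \<Longrightarrow> concentrated w \<Phi> \<Longrightarrow> \<Phi> u1 u2 u3 \<noteq> 0 \<Longrightarrow>
    \<exists>n. M3.pr (h3 + of_nat n) u3 \<noteq> 0 \<and> Re w + real n \<le> R"
proof -
  let ?S = "Re ` {l1 + l2 | l1 l2. M1.pr l1 u1 \<noteq> 0 \<and> M2.pr l2 u2 \<noteq> 0}"
  have "bdd_above ?S" using finite_weights by (intro bdd_above_finite finite_imageI)
  then obtain B where B: "\<And>x. x \<in> ?S \<Longrightarrow> x \<le> B" by (auto simp: bdd_above_def)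
  \<comment> \<open>The bound depends only on \<open>u1\<close> and \<open>u2\<close>. For fixed w
    it limits the degree n, which places the values in D(M^3); since n is nonnegative it also limits
    Re w, which gives the truncation axiom (i).\<close>
  have "\<exists>n. M3.pr (h3 + of_nat n) u3 \<noteq> 0 \<and> Re w + real n \<le> B - Re h3"
    if "trilinear \<Phi>" "concentrated w \<Phi>" "\<Phi> u1 u2 u3 \<noteq> 0" for w \<Phi> u3
  proof -
    from concentrated_nonzero[OF that] obtain l1 l2 l3
      where l: "M1.pr l1 u1 \<noteq> 0" "M2.pr l2 u2 \<noteq> 0" "M3.pr l3 u3 \<noteq> 0" "w = l1 + l2 - l3" .
    from M3.pr_weight[OF l(3)] obtain n where n: "l3 = h3 + of_nat n" by blast
    have "Re (l1 + l2) \<le> B" using l by (intro B) blast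
    then have "Re w + real n \<le> B - Re h3" using l(4) n by simp
    then show ?thesis using l(3) n by blast
  qed
  then show ?thesis using that by blast
qed

lemma intertwiner_of_block:
  assumes \<Phi>: "\<Phi> \<in> blocks"
  shows "(\<lambda>n \<alpha> u2 u1 u3. log_coeff n (\<alpha> + 1) \<Phi> u1 u2 u3) \<in> intertwiners"
proof -
  have tri: "trilinear \<Phi>" and block: "\<And>k a p q. a \<in> VD k \<Longrightarrow> form_sum (jacobi_term k a p q \<Phi>) = (\<lambda>u1 u2 u3. 0)"
    using \<Phi> blocks_iff by blast+
  let ?J = "\<lambda>n \<alpha>. log_coeff n (\<alpha> + 1) \<Phi>"
  note triP = trilinear_log_coeff[OF tri] and conc = concentrated_log_coeff[OF tri]
  have log_coeff_zero: "log_coeff n w (\<lambda>u1 u2 u3. 0) = (\<lambda>u1 u2 u3. 0)" for n w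
    using log_coeff_lincomb[OF tri tri, of n w 0 0] by simp
  have jacobi_term: "jacobi ?J k a p q n \<alpha> u1 u2 u3 = 0" if "a \<in> VD k" for k a p q n \<alpha> u1 u2 u3
    unfolding jacobi_log_coeff[OF tri that] block[OF that] log_coeff_zero ..
  have N: "\<exists>N. \<forall>m>N. \<forall>u3\<in>M3.ge (h3 + of_nat m). ?J n \<alpha> u1 u2 u3 = 0" for n \<alpha> u1 u2
  proof -
    obtain R where R: "\<And>w \<Phi> u3. trilinear \<Phi> \<Longrightarrow> concentrated w \<Phi> \<Longrightarrow> \<Phi> u1 u2 u3 \<noteq> 0 \<Longrightarrow>
        \<exists>n. M3.pr (h3 + of_nat n) u3 \<noteq> 0 \<and> Re w + real n \<le> R"
      by (rule concentrated_bound[of u1 u2]) blast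
    have "?J n \<alpha> u1 u2 u3 = 0" if "m > nat \<lceil>R - Re (\<alpha> + 1)\<rceil>" "u3 \<in> M3.ge (h3 + of_nat m)" for m u3
    proof (rule ccontr)
      assume "?J n \<alpha> u1 u2 u3 \<noteq> 0"
      then obtain m' where m': "M3.pr (h3 + of_nat m') u3 \<noteq> 0" "Re (\<alpha> + 1) + real m' \<le> R"
        using R[OF triP conc] by blast
      have "m' = m" using m'(1) M3.pr_ge_eq[OF that(2), of "h3 + of_nat m'"] by (simp split: if_splits)
      then show False using m'(2) that(1) by linarith
    qed
    then show ?thesis by blast
  qed
  have R: "\<exists>R. \<forall>\<alpha>. Re \<alpha> > R \<longrightarrow> ?J n \<alpha> u1 u2 = (\<lambda>u3. 0)" for u2 u1 n
  proof -
    obtain R where R: "\<And>w \<Phi> u3. trilinear \<Phi> \<Longrightarrow> concentrated w \<Phi> \<Longrightarrow> \<Phi> u1 u2 u3 \<noteq> 0 \<Longrightarrow>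
        \<exists>n. M3.pr (h3 + of_nat n) u3 \<noteq> 0 \<and> Re w + real n \<le> R"
      by (rule concentrated_bound[of u1 u2]) blast
    have "?J n \<alpha> u1 u2 u3 = 0" if "Re \<alpha> > R" for \<alpha> u3
    proof (rule ccontr)
      assume "?J n \<alpha> u1 u2 u3 \<noteq> 0"
      then obtain m where "Re (\<alpha> + 1) + real m \<le> R" using R[OF triP conc] by blast
      then show False using that by simp
    qed
    then show ?thesis by blast
  qed
  have d: "\<exists>d. \<forall>n>d. \<forall>\<alpha>. ?J n \<alpha> = (\<lambda>u1 u2 u3. 0)"
    using log_coeff_eventually_zero[OF tri] by (intro exI[of _ "Suc k1 + Suc k2 + Suc k3"]) simp
  \<comment> \<open>Axiom (ii) is the \<open>om\<close> identity at exponent \<alpha> - 1, that is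
    at weight \<alpha>, with T - \<alpha> replaced by means of the recursion for
    \<open>log_coeff\<close>.\<close>
  have L: "?J n \<alpha> u1 (Y2 om 0 u2) u3 = - \<alpha> * ?J n (\<alpha> - 1) u1 u2 u3 + of_nat (n + 1) * ?J (n + 1) (\<alpha> - 1) u1 u2 u3"
    for n \<alpha> u1 u2 u3
    using jacobi_term[OF om_VD, of 1 0 n "\<alpha> - 1" u1 u2 u3] weight_op_log_coeff[of "\<alpha>" n \<Phi> u1 u2 u3]
    by (simp add: jacobi_om algebra_simps add_eq_0_iff2 del: log_coeff.simps)
  show ?thesis
    unfolding mem_intertwiners[of ?J] by (intro conjI allI impI d triP N R L jacobi_term)
qed

lemma block_of_intertwiner:
  assumes I: "I \<in> intertwiners"
  obtains \<Phi> where "\<Phi> \<in> blocks" "I = (\<lambda>n \<alpha> u2 u1 u3. log_coeff n (\<alpha> + 1) \<Phi> u1 u2 u3)"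
proof -
  \<comment> \<open>\<open>I\<close> takes \<open>u2\<close> before \<open>u1\<close>;
    \<open>J\<close> restores the order used for forms.\<close>
  define J where "J n \<alpha> u1 u2 u3 = I n \<alpha> u2 u1 u3" for n \<alpha> u1 u2 u3
  have "(\<lambda>n \<alpha> u2 u1 u3. J n \<alpha> u1 u2 u3) \<in> intertwiners" using I by (simp add: J_def)
  note * = this[unfolded mem_intertwiners]
  obtain d where d: "\<forall>n>d. \<forall>\<alpha>. J n \<alpha> = (\<lambda>u1 u2 u3. 0)" using conjunct1[OF *] by (rule exE)
  note * = conjunct2[OF *]
  have tri: "trilinear (J n \<alpha>)" for n \<alpha> using conjunct1[OF *] by simp
  note * = conjunct2[OF conjunct2[OF conjunct2[OF *]]]
  have L: "J n \<alpha> u1 (Y2 om 0 u2) u3 = - \<alpha> * J n (\<alpha> - 1) u1 u2 u3 + of_nat (n + 1) * J (n + 1) (\<alpha> - 1) u1 u2 u3"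
    for n \<alpha> u1 u2 u3 using conjunct1[OF *] by (elim allE)
  have jacobi_term: "jacobi J k a p q n \<alpha> u1 u2 u3 = 0" if "a \<in> VD k" for k a p q n \<alpha> u1 u2 u3
    using conjunct2[OF *] that by simp
  \<comment> \<open>Inserting axiom (ii) at \<alpha> + 1 into the \<open>om\<close> identity cancels
    the terms (\<alpha> + 1) J and leaves the recursion satisfied by
    \<open>log_coeff\<close>.\<close>
  have weight_op: "weight_op (\<alpha> + 1) (J n \<alpha>) = (\<lambda>u1 u2 u3. - of_nat (n + 1) * J (n + 1) \<alpha> u1 u2 u3)" for n \<alpha>
  proof (intro ext)
    fix u1 u2 u3
    show "weight_op (\<alpha> + 1) (J n \<alpha>) u1 u2 u3 = - of_nat (n + 1) * J (n + 1) \<alpha> u1 u2 u3"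
      using jacobi_term[OF om_VD, of 1 0 n \<alpha> u1 u2 u3] L[of n "\<alpha> + 1" u1 u2 u3]
      unfolding jacobi_om add_diff_cancel_right' by algebra
  qed
  \<comment> \<open>Powers of T - \<alpha> - 1 turn \<open>J 0 \<alpha>\<close> into multiples of
    \<open>J n \<alpha>\<close>, which vanish beyond \<open>d\<close>.\<close>
  have conc: "concentrated (\<alpha> + 1) (J 0 \<alpha>)" for \<alpha>
  proof (rule weight_op_nilpotent_concentrated[OF tri])
    have "\<exists>c. (weight_op (\<alpha> + 1) ^^ n) (J 0 \<alpha>) = (\<lambda>u1 u2 u3. c * J n \<alpha> u1 u2 u3)" for n
    proof (induction n)
      case 0
      show ?case by (rule exI[of _ 1]) simp
    next
      case (Suc n)
      then obtain c where "(weight_op (\<alpha> + 1) ^^ n) (J 0 \<alpha>) = (\<lambda>u1 u2 u3. c * J n \<alpha> u1 u2 u3)" by blast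
      then have "(weight_op (\<alpha> + 1) ^^ Suc n) (J 0 \<alpha>) = (\<lambda>u1 u2 u3. (c * - of_nat (n + 1)) * J (Suc n) \<alpha> u1 u2 u3)"
        unfolding funpow.simps o_apply by (simp only: weight_op_scale weight_op mult.assoc Suc_eq_plus1)
      then show ?case by blast
    qed
    from this[of "Suc d"] show "(weight_op (\<alpha> + 1) ^^ Suc d) (J 0 \<alpha>) = (\<lambda>u1 u2 u3. 0)"
      by (simp add: d del: funpow.simps)
  qed
  \<comment> \<open>The value at z = 1, log z = 0. The next fact makes the sum finite: given vectors
    have finitely many weights, and concentration ties \<alpha> + 1 to them.\<close>
  define \<Phi> where "\<Phi> u1 u2 u3 = fsum (\<lambda>\<alpha>. J 0 \<alpha> u1 u2 u3)" for u1 u2 u3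
  have fin: "finite {\<alpha>. J 0 \<alpha> u1 u2 u3 \<noteq> 0}" for u1 u2 u3
  proof (rule finite_subset)
    let ?W = "{l1 + l2 | l1 l2. M1.pr l1 u1 \<noteq> 0 \<and> M2.pr l2 u2 \<noteq> 0}" and ?W3 = "{l. M3.pr l u3 \<noteq> 0}"
    show "finite ((\<lambda>(w, l). w - l - 1) ` (?W \<times> ?W3))"
      using finite_weights M3.finite_pr by blast
    show "{\<alpha>. J 0 \<alpha> u1 u2 u3 \<noteq> 0} \<subseteq> (\<lambda>(w, l). w - l - 1) ` (?W \<times> ?W3)"
    proof
      fix \<alpha> assume "\<alpha> \<in> {\<alpha>. J 0 \<alpha> u1 u2 u3 \<noteq> 0}"
      then have "J 0 \<alpha> u1 u2 u3 \<noteq> 0" by simp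
      from concentrated_nonzero[OF tri conc this] obtain l1 l2 l3 where
        l: "M1.pr l1 u1 \<noteq> 0" "M2.pr l2 u2 \<noteq> 0" "M3.pr l3 u3 \<noteq> 0" "\<alpha> + 1 = l1 + l2 - l3" .
      have "\<alpha> = (\<lambda>(w, l). w - l - 1) (l1 + l2, l3)" using l(4) by (simp add: algebra_simps)
      then show "\<alpha> \<in> (\<lambda>(w, l). w - l - 1) ` (?W \<times> ?W3)" by (rule image_eqI) (use l in blast)
    qed
  qed
  have tri\<Phi>: "trilinear \<Phi>"
    by (rule trilinearI; simp add: lin_form_def \<Phi>_def trilinear_add[OF tri] trilinear_scale[OF tri]
        fsum_add fsum_mult fin)
  \<comment> \<open>On a homogeneous triple only the summand whose exponent matches its weight is
    nonzero.\<close>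
  have comp: "comp (\<alpha> + 1) \<Phi> = J 0 \<alpha>" for \<alpha>
  proof (rule trilinear_eqI[OF trilinear_comp[OF tri\<Phi>] tri])
    fix l1 l2 l3 u1 u2 u3
    assume u: "u1 \<in> M1.ge l1" "u2 \<in> M2.ge l2" "u3 \<in> M3.ge l3"
    have z: "J 0 \<beta> u1 u2 u3 = 0" if "l1 + l2 - l3 \<noteq> \<beta> + 1" for \<beta>
      by (rule concentratedD[OF conc u that])
    show "comp (\<alpha> + 1) \<Phi> u1 u2 u3 = J 0 \<alpha> u1 u2 u3"
    proof (cases "l1 + l2 - l3 = \<alpha> + 1")
      case True
      have "\<Phi> u1 u2 u3 = (\<Sum>\<beta>\<in>{\<alpha>}. J 0 \<beta> u1 u2 u3)"
        unfolding \<Phi>_def by (rule fsum_eq_sum) (use z True in auto)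
      then show ?thesis using True by (simp add: comp_homogeneous[OF tri\<Phi> u])
    qed (simp add: comp_homogeneous[OF tri\<Phi> u] z)
  qed
  \<comment> \<open>Both families have the same start at n = 0 and obey the same recursion.\<close>
  have log_coeff: "log_coeff n (\<alpha> + 1) \<Phi> = J n \<alpha>" for n \<alpha>
  proof (induction n)
    case (Suc n)
    show ?case unfolding log_coeff.simps Suc.IH weight_op by (intro ext) (simp del: of_nat_Suc)
  qed (simp add: comp)
  have "form_sum (jacobi_term k a p q \<Phi>) = (\<lambda>u1 u2 u3. 0)" if a: "a \<in> VD k" for k a p q
  proof (rule comp_eqD)
    show "trilinear (form_sum (jacobi_term k a p q \<Phi>))"
      by (intro trilinear_form_sum locally_finite_jacobi_term trilinear_jacobi_term tri\<Phi> a)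
    show "trilinear (\<lambda>u1 u2 u3. 0)" by (simp add: trilinear_def lin_form_def)
    fix w :: complex
    \<comment> \<open>The exponent solves w = \<alpha> + p + q - k + 2, so the component of weight w
      is the Borcherds identity at this \<alpha> with n = 0.\<close>
    let ?\<alpha> = "w - of_int p - of_int q + of_nat k - 2"
    have "comp w (form_sum (jacobi_term k a p q \<Phi>)) u1 u2 u3 = jacobi (\<lambda>n \<alpha>. log_coeff n (\<alpha> + 1) \<Phi>) k a p q 0 ?\<alpha> u1 u2 u3" for u1 u2 u3
      unfolding jacobi_log_coeff[OF tri\<Phi> a] by simp
    then show "comp w (form_sum (jacobi_term k a p q \<Phi>)) = comp w (\<lambda>u1 u2 u3. 0)"
      by (intro ext) (simp add: log_coeff jacobi_term[OF a] comp_def)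
  qed
  then have "\<Phi> \<in> blocks" using tri\<Phi> blocks_iff by blast
  moreover have "I = (\<lambda>n \<alpha> u2 u1 u3. log_coeff n (\<alpha> + 1) \<Phi> u1 u2 u3)" by (simp add: log_coeff J_def)
  ultimately show ?thesis using that by blast
qed

end

theorem theorem4p1:
  fixes sV :: "complex \<Rightarrow> 'v::ab_group_add \<Rightarrow> 'v" and Y :: "'v \<Rightarrow> int \<Rightarrow> 'v \<Rightarrow> 'v"
    and vac om :: 'v
    and s1 :: "complex \<Rightarrow> 'm1::ab_group_add \<Rightarrow> 'm1" and Y1 :: "'v \<Rightarrow> int \<Rightarrow> 'm1 \<Rightarrow> 'm1"
    and s2 :: "complex \<Rightarrow> 'm2::ab_group_add \<Rightarrow> 'm2" and Y2 :: "'v \<Rightarrow> int \<Rightarrow> 'm2 \<Rightarrow> 'm2"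
    and s3 :: "complex \<Rightarrow> 'm3::ab_group_add \<Rightarrow> 'm3" and Y3 :: "'v \<Rightarrow> int \<Rightarrow> 'm3 \<Rightarrow> 'm3"
    and h1 h2 h3 :: complex and k1 k2 k3 :: nat
  assumes "is_VOA sV Y vac om"
    and "is_Ck_module sV Y vac om s1 Y1 h1 k1"
    and "is_Ck_module sV Y vac om s2 Y2 h2 k2"
    and "is_Ck_module sV Y vac om s3 Y3 h3 k3"
  shows "\<exists>F. bij_betw F (conformal_blocks sV Y om s1 Y1 s2 Y2 s3 Y3)
                      (log_intertwiners sV Y om s1 Y1 s2 Y2 s3 Y3 h3 k3)
           \<and> (\<forall>\<Phi>\<in>conformal_blocks sV Y om s1 Y1 s2 Y2 s3 Y3.
                \<forall>\<Psi>\<in>conformal_blocks sV Y om s1 Y1 s2 Y2 s3 Y3. \<forall>c::complex.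
                  F (\<lambda>u1 u2 u3. \<Phi> u1 u2 u3 + c * \<Psi> u1 u2 u3)
                  = (\<lambda>n \<alpha> u2 u1 u3. F \<Phi> n \<alpha> u2 u1 u3 + c * F \<Psi> n \<alpha> u2 u1 u3))"
proof -
  interpret voa_triple sV Y vac om s1 Y1 s2 Y2 s3 Y3 h1 h2 h3 k1 k2 k3
    by unfold_locales (fact assms)+
  define F where "F \<Phi> = (\<lambda>n \<alpha> u2 u1 u3. log_coeff n (\<alpha> + 1) \<Phi> u1 u2 u3)" for \<Phi>
  have tri: "trilinear \<Phi>" if "\<Phi> \<in> blocks" for \<Phi> using that blocks_iff by blast
  have "inj_on F blocks"
  proof (rule inj_onI)
    fix \<Phi> \<Psi> assume \<Phi>: "\<Phi> \<in> blocks" and \<Psi>: "\<Psi> \<in> blocks" and eq: "F \<Phi> = F \<Psi>"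
    have "comp w \<Phi> = comp w \<Psi>" for w
    proof (intro ext)
      fix u1 u2 u3
      \<comment> \<open>The coefficients of (log z)^0 are exactly the components of the form, with
        weight w sitting at exponent w - 1.\<close>
      have "F \<Phi> 0 (w - 1) u2 u1 u3 = F \<Psi> 0 (w - 1) u2 u1 u3" by (simp only: eq)
      then show "comp w \<Phi> u1 u2 u3 = comp w \<Psi> u1 u2 u3" by (simp add: F_def)
    qed
    then show "\<Phi> = \<Psi>" by (rule comp_eqD[OF tri[OF \<Phi>] tri[OF \<Psi>]])
  qed
  moreover have "F ` blocks = intertwiners"
  proof
    show "F ` blocks \<subseteq> intertwiners" using intertwiner_of_block by (auto simp: F_def)
    show "intertwiners \<subseteq> F ` blocks"
    proof
      fix I assume "I \<in> intertwiners"
      then obtain \<Phi> where "\<Phi> \<in> blocks" "I = F \<Phi>" unfolding F_def by (rule block_of_intertwiner)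
      then show "I \<in> F ` blocks" by blast
    qed
  qed
  moreover have "F (\<lambda>u1 u2 u3. \<Phi> u1 u2 u3 + c * \<Psi> u1 u2 u3) =
      (\<lambda>n \<alpha> u2 u1 u3. F \<Phi> n \<alpha> u2 u1 u3 + c * F \<Psi> n \<alpha> u2 u1 u3)"
    if "\<Phi> \<in> blocks" "\<Psi> \<in> blocks" for \<Phi> \<Psi> c
    using log_coeff_lincomb[OF tri[OF that(1)] tri[OF that(2)], of _ _ 1 c] by (simp add: F_def)
  ultimately show ?thesis unfolding bij_betw_def by blast
qed

end
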